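(* Let $w$ be a finite prime of $F$, $K$ the completion at $w$, $\phi$ a rank $r$ Drinfeld $A$-module over $K$ with stable reduction of rank $r'$, $1\le r'<r$, with Tate uniformization $(\psi,\Lambda,e_\phi)$, and let $\{\omega_i^0\}_{i=r'+1,\ldots,r}$ be an SMB of $\Lambda$. Let $u$ be a finite prime of $A$ and $n$ a positive integer with $|u^n|_\infty>|\omega_r^0|/|\omega_{r'+1}^0|$, and let $\{\lambda_i\}_{i=1,\ldots,r}$ be an SMB of $\phi[u^n]$. Then for each $i$ there is a unique $\omega_i'\in\mathbb{C}_w$ with $|\omega_i'|<|\omega_{r'+1}^0|$ and $e_\phi(\omega_i')=\lambda_i$, and: (1) $\{\omega_i'\}_{i=1,\ldots,r'}$ is an SMB of $\psi[u^n]$; (2) $\{u^n\cdot_\psi\omega_i'\}_{i=r'+1,\ldots,r}$ is an SMB of $\Lambda$.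
   Context: $q$ a power of a prime $p$, $A=\mathbb{F}_q[t]$, $F$ a finite extension of $\mathbb{F}_q(t)$; a finite prime of $F$ does not lie over $1/t$. $K$ the completion at $w$, $w$ its normalized valuation extended to $K^{\mathrm{sep}}$ and $\mathbb{C}_w$. Rank $r$ Drinfeld module: $\phi_t(X)=tX+a_1X^q+\cdots+a_rX^{q^r}$, $a_r\ne0$; $a\cdot_\phi x=\phi_a(x)$. Stable reduction of rank $r'$: all $a_i$ integral, $a_{r'}$ a unit, $w(a_i)>0$ for $i>r'$; good reduction: $r'=r$. For a rank $s$ Drinfeld module $\rho$ and monic irreducible $u\in A$, $\rho[u^n]$ is the $A/u^n$-module of roots of $\rho_{u^n}(X)$, and an SMB of $\rho[u^n]$ is $\{\lambda_i\}_{i=1}^s\subset\rho[u^n]$ with, for each $i$, $\lambda_1,\dots,\lambda_i$ $A/u^n$-linearly independent and $w(\lambda_i)$ largest among $w(\lambda)$ for $\lambda\in\rho[u^n]$ with $\lambda_1,\dots,\lambda_{i-1},\lambda$ $A/u^n$-linearly independent. Tate uniformization: rank $r'$ Drinfeld module $\psi$ over $K$ with good reduction; Galois-stable $A$-lattice $\Lambda\subset\mathbb{C}_w$ of rank $r-r'$ under $a\cdot_\psi z=\psi_a(z)$, nonzero elements of negative valuation; $e_\phi(z)=z\prod_{\mu\in\Lambda\setminus\{0\}}(1-z/\mu)$ surjective with kernel $\Lambda$, $e_\phi(\psi_a(z))=\phi_a(e_\phi(z))$. $|x|=(-w(x))^{1/r'}$ if $w(x)<0$, $-(w(x))^{1/r'}$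 if $w(x)\ge0$, $|0|=-\infty$; $|a|_\infty=q^{\deg a}$ for $a\in A$. SMB of $\Lambda$: $\{\omega_i^0\}_{i=r'+1}^r\subset\Lambda$ with each initial segment $A$-linearly independent (via $\psi$) and $|\omega^0_i|$ minimal among $|\omega|$, $\omega\in\Lambda$, with $\omega^0_{r'+1},\dots,\omega^0_{i-1},\omega$ $A$-linearly independent. *)

theory Defs
  imports "HOL-Analysis.Analysis" "HOL-Computational_Algebra.Computational_Algebra"
begin

text \<open>
  Conventions. \<open>'k\<close> is the finite field with \<open>q = CARD('k)\<close> elements, so \<open>'k poly\<close> is
  \<open>A = F\<^sub>q[t]\<close> and \<open>'k poly fract\<close> is \<open>F\<^sub>q(t)\<close>. The type \<open>'c\<close> is the field \<open>C\<^sub>w\<close>; the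
  fields \<open>F\<close> and \<open>K\<close> are subfields of it, and \<open>\<iota>\<close> is the embedding of \<open>F\<^sub>q(t)\<close> into \<open>C\<^sub>w\<close>.
  Valuations are additive, with value \<open>\<infinity>\<close> exactly at \<open>0\<close>.
\<close>

definition is_subfield :: "'c::field set \<Rightarrow> bool" where
  "is_subfield S \<longleftrightarrow> 0 \<in> S \<and> 1 \<in> S \<and>
     (\<forall>x\<in>S. \<forall>y\<in>S. x + y \<in> S \<and> x * y \<in> S) \<and> (\<forall>x\<in>S. - x \<in> S \<and> inverse x \<in> S)"

definition is_field_hom :: "('a::field \<Rightarrow> 'b::field) \<Rightarrow> bool" where
  "is_field_hom h \<longleftrightarrow> h 1 = 1 \<and> (\<forall>x y. h (x + y) = h x + h y) \<and> (\<forall>x y. h (x * y) = h x * h y)"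

definition algebraic_over :: "'c::field set \<Rightarrow> 'c \<Rightarrow> bool" where
  "algebraic_over S x \<longleftrightarrow> (\<exists>p. p \<noteq> 0 \<and> (\<forall>i. coeff p i \<in> S) \<and> poly p x = 0)"

definition is_valuation :: "('c::field \<Rightarrow> ereal) \<Rightarrow> bool" where
  "is_valuation w \<longleftrightarrow>
     (\<forall>x. w x = \<infinity> \<longleftrightarrow> x = 0) \<and> (\<forall>x. w x \<noteq> -\<infinity>) \<and>
     (\<forall>x y. w (x * y) = w x + w y) \<and> (\<forall>x y. min (w x) (w y) \<le> w (x + y))"

definition val_complete :: "('c::field \<Rightarrow> ereal) \<Rightarrow> 'c set \<Rightarrow> bool" where
  "val_complete w S \<longleftrightarrow>
     (\<forall>X :: nat \<Rightarrow> 'c. range X \<subseteq> S \<longrightarrow>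
        (\<forall>B::real. \<exists>N. \<forall>m\<ge>N. \<forall>n\<ge>N. ereal B < w (X m - X n)) \<longrightarrow>
        (\<exists>L\<in>S. (\<lambda>n. w (X n - L)) \<longlonglongrightarrow> \<infinity>))"

definition val_dense :: "('c::field \<Rightarrow> ereal) \<Rightarrow> 'c set \<Rightarrow> 'c set \<Rightarrow> bool" where
  "val_dense w D S \<longleftrightarrow> D \<subseteq> S \<and> (\<forall>x\<in>S. \<forall>B::real. \<exists>y\<in>D. ereal B < w (x - y))"

text \<open>
  \<open>F\<close> is a finite extension of \<open>F\<^sub>q(t)\<close>, the restriction of \<open>w\<close> to \<open>F\<close> is the normalized
  valuation of a prime of \<open>F\<close> not over \<open>1/t\<close> (i.e. \<open>1/t\<close> is not in the maximal ideal of the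
  prime), \<open>K\<close> is the completion of \<open>F\<close> and \<open>'c\<close> is the completion of an algebraic closure of
  \<open>K\<close>. Completions are characterized up to unique isomorphism as complete valued extensions
  containing the given field densely.
\<close>

locale completed_function_field =
  fixes \<iota> :: "'k::{field,finite} poly fract \<Rightarrow> 'c::alg_closed_field"
    and w :: "'c \<Rightarrow> ereal"
    and F K :: "'c set"
  assumes embedding: "is_field_hom \<iota>"
    and F_subfield: "is_subfield F"
    and F_extension: "range \<iota> \<subseteq> F"
    and F_finite: "\<exists>B. finite B \<and> B \<subseteq> F \<and> (\<forall>x\<in>F. \<exists>c. x = (\<Sum>b\<in>B. \<iota> (c b) * b))"
    and valuation: "is_valuation w"
    and normalized: "w ` (F - {0}) = range (\<lambda>k::int. ereal (of_int k))"
    and finite_prime: "\<not> 0 < w (1 / \<iota> (to_fract [:0, 1:]))"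
    and K_subfield: "is_subfield K"
    and K_complete: "val_complete w K"
    and F_dense: "val_dense w F K"
    and C_complete: "val_complete w UNIV"
    and algebraic_dense: "val_dense w {x. algebraic_over K x} UNIV"

text \<open>
  The coefficient \<open>a\<^sub>i\<close> in \<open>\<rho>\<^sub>t(X) = t X + a\<^sub>1 X\<^sup>q + \<dots>\<close>, where a Drinfeld module \<open>\<rho>\<close>
  is given by the family of polynomials \<open>\<rho>\<^sub>a\<close>, \<open>a \<in> A\<close>.
\<close>

definition dm_coeff :: "('k::{field,finite} poly \<Rightarrow> 'c::field poly) \<Rightarrow> nat \<Rightarrow> 'c" where
  "dm_coeff \<rho> i = coeff (\<rho> [:0, 1:]) (CARD('k) ^ i)"

definition drinfeld_module ::
  "('k::{field,finite} poly fract \<Rightarrow> 'c::field) \<Rightarrow> 'c set \<Rightarrow> nat \<Rightarrow> ('k poly \<Rightarrow> 'c poly) \<Rightarrow> bool" where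
  "drinfeld_module \<iota> K s \<rho> \<longleftrightarrow>
     1 \<le> s \<and>
     (\<forall>a b. \<rho> (a + b) = \<rho> a + \<rho> b) \<and>
     (\<forall>a b. \<rho> (a * b) = pcompose (\<rho> a) (\<rho> b)) \<and>
     (\<forall>c. \<rho> [:c:] = [:0, \<iota> (to_fract [:c:]):]) \<and>
     \<rho> [:0, 1:] = (\<Sum>i\<le>s. monom (dm_coeff \<rho> i) (CARD('k) ^ i)) \<and>
     (\<forall>i\<le>s. dm_coeff \<rho> i \<in> K) \<and>
     dm_coeff \<rho> 0 = \<iota> (to_fract [:0, 1:]) \<and>
     dm_coeff \<rho> s \<noteq> 0"

abbreviation dm_act :: "('k::{field,finite} poly \<Rightarrow> 'c::field poly) \<Rightarrow> 'k poly \<Rightarrow> 'c \<Rightarrow> 'c" where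
  "dm_act \<rho> a x \<equiv> poly (\<rho> a) x"

definition stable_reduction ::
  "('c::field \<Rightarrow> ereal) \<Rightarrow> nat \<Rightarrow> nat \<Rightarrow> ('k::{field,finite} poly \<Rightarrow> 'c poly) \<Rightarrow> bool" where
  "stable_reduction w r r' \<rho> \<longleftrightarrow>
     r' \<le> r \<and> (\<forall>i\<in>{1..r}. 0 \<le> w (dm_coeff \<rho> i)) \<and>
     w (dm_coeff \<rho> r') = 0 \<and> (\<forall>i\<in>{r'<..r}. 0 < w (dm_coeff \<rho> i))"

definition good_reduction ::
  "('c::field \<Rightarrow> ereal) \<Rightarrow> nat \<Rightarrow> ('k::{field,finite} poly \<Rightarrow> 'c poly) \<Rightarrow> bool" where
  "good_reduction w s \<rho> \<longleftrightarrow> stable_reduction w s s \<rho>"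

definition torsion :: "('k::{field,finite} poly \<Rightarrow> 'c::field poly) \<Rightarrow> 'k poly \<Rightarrow> 'c set" where
  "torsion \<rho> a = {x. poly (\<rho> a) x = 0}"

definition A_independent ::
  "('k::{field,finite} poly \<Rightarrow> 'c::field poly) \<Rightarrow> nat set \<Rightarrow> (nat \<Rightarrow> 'c) \<Rightarrow> bool" where
  "A_independent \<rho> I x \<longleftrightarrow> (\<forall>c. (\<Sum>j\<in>I. dm_act \<rho> (c j) (x j)) = 0 \<longrightarrow> (\<forall>j\<in>I. c j = 0))"

text \<open>
  Linear independence over \<open>A/m\<close> of elements of \<open>\<rho>[m]\<close>: the scalars in \<open>A/m\<close> are
  represented by elements of \<open>A\<close>, whose class vanishes iff \<open>m\<close> divides them.
\<close>

definition A_mod_independent ::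
  "('k::{field,finite} poly \<Rightarrow> 'c::field poly) \<Rightarrow> 'k poly \<Rightarrow> nat set \<Rightarrow> (nat \<Rightarrow> 'c) \<Rightarrow> bool" where
  "A_mod_independent \<rho> m I x \<longleftrightarrow>
     (\<forall>c. (\<Sum>j\<in>I. dm_act \<rho> (c j) (x j)) = 0 \<longrightarrow> (\<forall>j\<in>I. m dvd c j))"

text \<open>
  Successive minimum bases. In both definitions \<open>x(i := y)\<close> restricted to the indices up to
  \<open>i\<close> is the family \<open>\<dots>, x\<^bsub>i-1\<^esub>, y\<close>.
\<close>

definition torsion_SMB ::
  "('c::field \<Rightarrow> ereal) \<Rightarrow> ('k::{field,finite} poly \<Rightarrow> 'c poly) \<Rightarrow> nat \<Rightarrow> 'k poly \<Rightarrow> (nat \<Rightarrow> 'c) \<Rightarrow> bool"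
  where
  "torsion_SMB w \<rho> s m x \<longleftrightarrow>
     (\<forall>i\<in>{1..s}. x i \<in> torsion \<rho> m \<and> A_mod_independent \<rho> m {1..i} x \<and>
        (\<forall>y\<in>torsion \<rho> m. A_mod_independent \<rho> m {1..i} (x(i := y)) \<longrightarrow> w y \<le> w (x i)))"

definition val_abs :: "('c::field \<Rightarrow> ereal) \<Rightarrow> nat \<Rightarrow> 'c \<Rightarrow> ereal" where
  "val_abs w r' x =
     (if x = 0 then -\<infinity>
      else if w x < 0 then ereal ((- real_of_ereal (w x)) powr (1 / real r'))
      else ereal (- (real_of_ereal (w x) powr (1 / real r'))))"

definition deg_abs :: "'k::{field,finite} poly \<Rightarrow> real" where
  "deg_abs a = (if a = 0 then 0 else real CARD('k) ^ degree a)"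

text \<open>The parameters \<open>r'\<close> and \<open>r\<close> give the index range \<open>r'+1, \<dots>, r\<close>.\<close>

definition lattice_SMB ::
  "('c::field \<Rightarrow> ereal) \<Rightarrow> ('k::{field,finite} poly \<Rightarrow> 'c poly) \<Rightarrow> 'c set \<Rightarrow> nat \<Rightarrow> nat \<Rightarrow>
   (nat \<Rightarrow> 'c) \<Rightarrow> bool" where
  "lattice_SMB w \<psi> \<Lambda> r' r x \<longleftrightarrow>
     (\<forall>i\<in>{r'+1..r}. x i \<in> \<Lambda> \<and> A_independent \<psi> {r'+1..i} x \<and>
        (\<forall>y\<in>\<Lambda>. A_independent \<psi> {r'+1..i} (x(i := y)) \<longrightarrow> val_abs w r' (x i) \<le> val_abs w r' y))"

text \<open>
  An \<open>A\<close>-lattice of rank \<open>d\<close>: a discrete submodule for the action through \<open>\<psi>\<close> (finitely many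
  elements in every ball) that is finitely generated and projective of rank \<open>d\<close>, i.e. free of
  rank \<open>d\<close>, as \<open>A\<close> is a principal ideal domain.
\<close>

definition A_lattice ::
  "('c::field \<Rightarrow> ereal) \<Rightarrow> ('k::{field,finite} poly \<Rightarrow> 'c poly) \<Rightarrow> nat \<Rightarrow> 'c set \<Rightarrow> bool" where
  "A_lattice w \<psi> d \<Lambda> \<longleftrightarrow>
     (\<exists>b. A_independent \<psi> {1..d} b \<and> \<Lambda> = range (\<lambda>c. \<Sum>j\<in>{1..d}. dm_act \<psi> (c j) (b j))) \<and>
     (\<forall>B::real. finite {x\<in>\<Lambda>. ereal B \<le> w x})"

text \<open>
  The Galois group of \<open>K\<close> acts on \<open>C\<^sub>w\<close> by continuous extension from \<open>K\<^sup>s\<^sup>e\<^sup>p\<close>, and is thereby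
  identified with the group of continuous automorphisms of \<open>C\<^sub>w\<close> over \<open>K\<close>. For an additive map
  it suffices to require continuity at \<open>0\<close>.
\<close>

definition galois_group :: "('c::field \<Rightarrow> ereal) \<Rightarrow> 'c set \<Rightarrow> ('c \<Rightarrow> 'c) set" where
  "galois_group w K =
     {\<sigma>. is_field_hom \<sigma> \<and> bij \<sigma> \<and> (\<forall>x\<in>K. \<sigma> x = x) \<and>
         (\<forall>B::real. \<exists>C::real. \<forall>x. ereal C < w x \<longrightarrow> ereal B < w (\<sigma> x))}"

definition is_lattice_exp :: "('c::field \<Rightarrow> ereal) \<Rightarrow> 'c set \<Rightarrow> ('c \<Rightarrow> 'c) \<Rightarrow> bool" where
  "is_lattice_exp w \<Lambda> e \<longleftrightarrow>
     (\<forall>z. ((\<lambda>S. w (e z - z * (\<Prod>\<mu>\<in>S. 1 - z / \<mu>))) \<longlongrightarrow> \<infinity>) (finite_subsets_at_top (\<Lambda> - {0})))"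

definition tate_uniformization ::
  "('k::{field,finite} poly fract \<Rightarrow> 'c::field) \<Rightarrow> ('c \<Rightarrow> ereal) \<Rightarrow> 'c set \<Rightarrow> nat \<Rightarrow> nat \<Rightarrow>
   ('k poly \<Rightarrow> 'c poly) \<Rightarrow> ('k poly \<Rightarrow> 'c poly) \<Rightarrow> 'c set \<Rightarrow> ('c \<Rightarrow> 'c) \<Rightarrow> bool" where
  "tate_uniformization \<iota> w K r r' \<phi> \<psi> \<Lambda> e \<longleftrightarrow>
     drinfeld_module \<iota> K r' \<psi> \<and> good_reduction w r' \<psi> \<and>
     A_lattice w \<psi> (r - r') \<Lambda> \<and>
     (\<forall>\<sigma>\<in>galois_group w K. \<sigma> ` \<Lambda> = \<Lambda>) \<and>
     (\<forall>\<mu>\<in>\<Lambda> - {0}. w \<mu> < 0) \<and>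
     is_lattice_exp w \<Lambda> e \<and> surj e \<and> {z. e z = 0} = \<Lambda> \<and>
     (\<forall>a z. e (dm_act \<psi> a z) = dm_act \<phi> a (e z))"

end

theory Submission
  imports Defs
begin

text \<open>
  On the disc of all \<open>z\<close> smaller than every nonzero lattice element, \<open>e\<close> is a bijection onto the same
  disc and preserves valuations; so the \<open>\<omega>'\<^sub>i\<close> exist uniquely once all \<open>\<lambda>\<^sub>i\<close> are known to lie in it.
  The dimension over \<open>A/u\<close> of the points \<open>z\<close> with \<open>\<psi>\<^sub>u(z)\<close> in the span of \<open>\<omega>\<^sup>0\<^bsub>r'+1\<^esub>, \<dots>, \<omega>\<^sup>0\<^sub>i\<close>, counted
  modulo \<open>\<Lambda>\<close>, is \<open>i\<close>. Therefore \<open>\<psi>[u\<^sup>n]\<close> and the \<open>u\<^sup>n\<close>-division points of \<open>\<omega>\<^sup>0\<^bsub>r'+1\<^esub>, \<dots>, \<omega>\<^sup>0\<^sub>i\<close>, which are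
  small by the hypothesis on \<open>u\<^sup>n\<close>, contain a point independent of \<open>\<lambda>\<^sub>1, \<dots>, \<lambda>\<^bsub>i-1\<^esub>\<close>, and the maximality
  of \<open>w(\<lambda>\<^sub>i)\<close> makes \<open>\<lambda>\<^sub>i\<close> small. For the lattice, a combination of lattice vectors that lies in \<open>\<psi>\<^sub>u(\<Lambda>)\<close>
  although one of its scalars is prime to \<open>u\<close> can, after reducing the scalars modulo \<open>u\<close>, be divided by \<open>u\<close>
  to give a strictly smaller vector. This descent shows both that successive minima remain independent
  modulo \<open>u\<close> and that the \<open>u\<^sup>n\<omega>'\<^sub>i\<close> are successive minima.
\<close>

section \<open>Polynomials over fields\<close>

lemma two_le_card_field: "2 \<le> CARD('k::{field,finite})"
proof -
  have "card {0, 1 :: 'k} \<le> CARD('k)"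
    by (rule card_mono) auto
  then show ?thesis
    by simp
qed

definition residues :: "'k::field poly \<Rightarrow> 'k poly set" where
  "residues m = {p. p = 0 \<or> degree p < degree m}"

lemma card_degree_less:
  "finite {p :: 'k::{field,finite} poly. p = 0 \<or> degree p < d} \<and>
   card {p :: 'k poly. p = 0 \<or> degree p < d} = CARD('k) ^ d"
proof (induction d)
  case (Suc d)
  let ?S = "\<lambda>d. {p :: 'k poly. p = 0 \<or> degree p < d}"
  have "?S (Suc d) = (\<lambda>(a, p). pCons a p) ` (UNIV \<times> ?S d)"
  proof (intro equalityI subsetI)
    fix p assume "p \<in> ?S (Suc d)"
    then show "p \<in> (\<lambda>(a, p). pCons a p) ` (UNIV \<times> ?S d)"
      by (cases p) (auto simp: image_iff split: if_splits)
  next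
    fix p assume "p \<in> (\<lambda>(a, p). pCons a p) ` (UNIV \<times> ?S d)"
    then show "p \<in> ?S (Suc d)"
      by (auto simp: degree_pCons_eq_if split: if_splits)
  qed
  moreover have "inj_on (\<lambda>(a, p :: 'k poly). pCons a p) X" for X
    by (auto simp: inj_on_def)
  ultimately show ?case
    using Suc by (auto simp: card_image card_cartesian_product)
qed simp

lemma finite_residues [simp]: "finite (residues (m :: 'k::{field,finite} poly))"
  and card_residues: "card (residues m) = CARD('k) ^ degree m"
  using card_degree_less[where ?'k = 'k, of "degree m"] unfolding residues_def by auto

lemma mod_in_residues: "m \<noteq> 0 \<Longrightarrow> p mod m \<in> residues m"
  using degree_mod_less[of m p] by (auto simp: residues_def)

lemma one_less_card_residues:
  fixes m :: "'k::{field,finite} poly"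
  assumes "0 < degree m"
  shows "1 < card (residues m)"
  unfolding card_residues using two_le_card_field[where ?'k = 'k] assms
  by (intro one_less_power) auto

lemma residues_eqI:
  assumes "p \<in> residues m" and "p' \<in> residues m" and "m dvd p - p'"
  shows "p = p'"
proof -
  have "p - p' = 0 \<or> degree (p - p') < degree m"
    using assms(1,2) by (auto simp: residues_def intro: le_less_trans[OF degree_diff_le_max])
  then show ?thesis
    using dvd_imp_degree_le[OF assms(3)] by (metis right_minus_eq not_less)
qed

lemma PiE_residues_eqI:
  assumes "c \<in> I \<rightarrow>\<^sub>E residues m" and "d \<in> I \<rightarrow>\<^sub>E residues m" and "\<forall>j\<in>I. m dvd c j - d j"
  shows "c = d"
  using assms by (intro PiE_ext[OF assms(1,2)] residues_eqI[where m = m]) auto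

lemma prime_elem_degree_pos:
  fixes u :: "'k::field poly"
  assumes "prime_elem u"
  shows "0 < degree u"
  using assms by (auto simp: prime_elem_def is_unit_iff_degree)

lemma ex_common_divisor_combination:
  fixes p q :: "'k::field poly"
  obtains a b where "a * p + b * q dvd p" "a * p + b * q dvd q"
proof (cases "p = 0 \<and> q = 0")
  case True
  then show ?thesis
    using that[of 0 0] by simp
next
  case False
  define I where "I = {a * p + b * q | a b. True}"
  have "p = 1 * p + 0 * q" and "q = 0 * p + 1 * q"
    by simp_all
  then have pq: "p \<in> I" "q \<in> I"
    unfolding I_def by blast+
  with False obtain d where d: "d \<in> I" "d \<noteq> 0"
    and min: "\<And>f. f \<in> I \<Longrightarrow> f \<noteq> 0 \<Longrightarrow> degree d \<le> degree f"
    using ex_has_least_nat[of "\<lambda>f. f \<in> I \<and> f \<noteq> 0" _ degree] by metis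
  obtain a b where ab: "d = a * p + b * q"
    using d(1) unfolding I_def by blast
  have "d dvd f" if "f \<in> I" for f
  proof (rule ccontr)
    assume "\<not> d dvd f"
    then have "f mod d \<noteq> 0"
      by (simp add: dvd_eq_mod_eq_0)
    moreover obtain a' b' where "f = a' * p + b' * q"
      using \<open>f \<in> I\<close> unfolding I_def by blast
    then have "f mod d = (a' - f div d * a) * p + (b' - f div d * b) * q"
      by (simp add: ab algebra_simps flip: minus_div_mult_eq_mod)
    then have "f mod d \<in> I"
      unfolding I_def by blast
    ultimately show False
      using min[of "f mod d"] degree_mod_less[OF d(2), of f] by simp
  qed
  then show ?thesis
    using that[of a b] pq by (simp flip: ab)
qed

lemma prime_elem_bezout:
  fixes u c :: "'k::field poly"
  assumes u: "prime_elem u" and "\<not> u dvd c"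
  obtains a b where "a * c + b * u = 1"
proof -
  obtain a b where ab: "a * c + b * u dvd c" "a * c + b * u dvd u"
    by (rule ex_common_divisor_combination)
  then obtain k where k: "u = (a * c + b * u) * k"
    by (elim dvdE)
  moreover have "\<not> k dvd 1"
    using k ab(1) assms(2) mult_unit_dvd_iff by metis
  ultimately have "a * c + b * u dvd 1"
    using prime_elem_imp_irreducible[OF u] irreducibleD by blast
  then obtain d where "1 = (a * c + b * u) * d"
    by (elim dvdE)
  then have "(d * a) * c + (d * b) * u = 1"
    by (simp add: algebra_simps)
  then show ?thesis
    by (rule that)
qed

lemma rsquarefreeI_pderiv:
  fixes p :: "'a::idom poly"
  assumes "p \<noteq> 0" and "\<And>x. poly p x = 0 \<Longrightarrow> poly (pderiv p) x \<noteq> 0"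
  shows "rsquarefree p"
proof -
  have "order x p < 2" for x
  proof (rule ccontr)
    assume "\<not> order x p < 2"
    then have "[:- x, 1:] ^ 2 dvd p"
      using order_divides[of x 2 p] by simp
    then obtain s where "p = [:- x, 1:] ^ 2 * s"
      by (elim dvdE)
    then have "p = [:- x, 1:] * ([:- x, 1:] * s)"
      by (simp only: power2_eq_square mult.assoc)
    then have "poly p x = 0" and "poly (pderiv p) x = 0"
      by (simp, simp only: pderiv_mult poly_add poly_mult, simp)
    then show False
      using assms(2) by blast
  qed
  then have "order x p = 0 \<or> order x p = 1" for x
    by (metis less_2_cases One_nat_def)
  then show ?thesis
    using assms(1) by (simp add: rsquarefree_def)
qed

lemma size_proots_alg_closed: "size (proots p) = degree p" for p :: "'a::alg_closed_field poly"
proof (cases "p = 0")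
  case False
  then obtain A where A: "size A = degree p" "p = smult (lead_coeff p) (\<Prod>x\<in>#A. [:- x, 1:])"
    using alg_closed_imp_factorization by blast
  have "proots (\<Prod>x\<in>#A. [:- x, 1:]) = A"
  proof (induction A)
    case (add x A)
    have "(\<Prod>x\<in>#A. [:- x, 1:]) \<noteq> 0"
      by (auto simp: prod_mset_zero_iff)
    then show ?case
      using add by (simp add: proots_mult del: mult_pCons_left)
  qed simp
  then have "proots p = A"
    using False by (subst A(2)) simp
  then show ?thesis
    using A(1) by simp
qed simp

lemma card_roots_rsquarefree:
  fixes p :: "'a::alg_closed_field poly"
  assumes "rsquarefree p"
  shows "card {x. poly p x = 0} = degree p"
proof -
  have p: "p \<noteq> 0"
    using assms by (simp add: rsquarefree_def)
  have "order x p = (if poly p x = 0 then 1 else 0)" for x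
    using assms p order_root[of p x] unfolding rsquarefree_def by (metis gr0I)
  then have "proots p = mset_set {x. poly p x = 0}"
    using p poly_roots_finite[OF p] by (intro multiset_eqI) (simp add: count_mset_set')
  then show ?thesis
    using size_proots_alg_closed[of p] by simp
qed

definition vanishing_poly :: "'c::field set \<Rightarrow> 'c poly" where
  "vanishing_poly G = (\<Prod>g\<in>G. [:- g, 1:])"

lemma poly_vanishing_poly: "poly (vanishing_poly G) x = (\<Prod>g\<in>G. x - g)"
  by (simp add: vanishing_poly_def poly_prod)

lemma degree_vanishing_poly: "degree (vanishing_poly G) = card G"
  unfolding vanishing_poly_def by (subst degree_prod_eq_sum_degree) simp_all

lemma lead_coeff_vanishing_poly: "lead_coeff (vanishing_poly G) = 1"
  unfolding vanishing_poly_def by (subst lead_coeff_prod) simp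

lemma vanishing_poly_eqI:
  assumes "finite G" and "degree p = card G" and "lead_coeff p = 1"
    and "\<And>g. g \<in> G \<Longrightarrow> poly p g = 0"
  shows "vanishing_poly G = p"
proof (rule poly_eqI_degree_lead_coeff[where A = G and n = "card G"])
  show "coeff (vanishing_poly G) (card G) = coeff p (card G)"
    using assms(2,3) lead_coeff_vanishing_poly[of G] by (simp add: degree_vanishing_poly)
qed (use assms in \<open>auto simp: degree_vanishing_poly poly_vanishing_poly\<close>)

text \<open>For fixed \<open>y\<close>, both sides are monic polynomials in \<open>x\<close> of degree \<open>card G\<close> up to a constant,
  and they agree on \<open>G\<close>.\<close>

lemma poly_vanishing_poly_add:
  fixes G :: "'c::field set"
  assumes fin: "finite G" and zero: "0 \<in> G"
    and add: "\<And>x y. x \<in> G \<Longrightarrow> y \<in> G \<Longrightarrow> x + y \<in> G"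
    and minus: "\<And>x. x \<in> G \<Longrightarrow> - x \<in> G"
  shows "poly (vanishing_poly G) (x + y) = poly (vanishing_poly G) x + poly (vanishing_poly G) y"
proof -
  let ?p = "vanishing_poly G"
  define d where "d = pcompose ?p [:y, 1:] + [:- poly ?p y:]"
  have pos: "0 < degree (pcompose ?p [:y, 1:])"
    using fin zero by (auto simp: degree_pcompose degree_vanishing_poly card_gt_0_iff)
  have "?p = d"
  proof (rule vanishing_poly_eqI[OF fin])
    show "degree d = card G"
      unfolding d_def using pos
      by (subst degree_add_eq_left) (auto simp: degree_pcompose degree_vanishing_poly)
    then have "lead_coeff d = lead_coeff (pcompose ?p [:y, 1:])"
      using pos by (cases "card G") (auto simp: d_def degree_pcompose degree_vanishing_poly)
    then show "lead_coeff d = 1"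
      by (simp add: lead_coeff_comp lead_coeff_vanishing_poly)
    fix h assume h: "h \<in> G"
    have "bij_betw (\<lambda>g. g - h) G G"
      using add[OF _ minus[OF h]] add[OF _ h] by (intro bij_betwI[where g = "\<lambda>g. g + h"]) auto
    then have "(\<Prod>g\<in>G. y - (g - h)) = (\<Prod>g\<in>G. y - g)"
      by (rule prod.reindex_bij_betw[where g = "\<lambda>g. y - g"])
    then show "poly d h = 0"
      by (simp add: d_def poly_pcompose poly_vanishing_poly algebra_simps)
  qed
  then have "poly ?p x = poly d x"
    by simp
  then show ?thesis
    by (simp add: d_def poly_pcompose add.commute)
qed

section \<open>Homomorphisms of fields\<close>

locale field_hom =
  fixes h :: "'a::field \<Rightarrow> 'b::field"
  assumes is_hom: "is_field_hom h"
begin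

lemma hom_add: "h (x + y) = h x + h y"
  and hom_mult: "h (x * y) = h x * h y"
  and hom_1 [simp]: "h 1 = 1"
  using is_hom by (auto simp: is_field_hom_def)

lemma hom_0 [simp]: "h 0 = 0"
  using hom_add[of 0 0] by (metis add_cancel_right_right add_0)

lemma hom_minus: "h (- x) = - h x"
  using hom_add[of x "- x"] by (simp add: eq_neg_iff_add_eq_0 add.commute)

lemma hom_eq_0_iff [simp]: "h x = 0 \<longleftrightarrow> x = 0"
  using hom_mult[of x "inverse x"] by (cases "x = 0") auto

lemma inj_hom: "inj h"
proof (rule injI)
  fix x y assume "h x = h y"
  then have "h (x + - y) = 0"
    unfolding hom_add hom_minus by simp
  then show "x = y"
    unfolding hom_eq_0_iff by simp
qed

lemma hom_power: "h (x ^ n) = h x ^ n"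
  by (induction n) (auto simp: hom_mult)

end

text \<open>The class \<open>finite_field\<close>, for which the library has this fact, is not implied by
  the sort \<open>{field, finite}\<close>.\<close>

lemma finite_field_power_card:
  fixes x :: "'k::{field,finite}"
  shows "x ^ CARD('k) = x"
proof (cases "x = 0")
  case False
  have "bij_betw ((*) x) (UNIV - {0}) (UNIV - {0})"
    using False by (intro bij_betwI[where g = "\<lambda>y. y / x"]) auto
  then have "(\<Prod>y\<in>UNIV - {0}. x * y) = \<Prod>(UNIV - {0})"
    by (rule prod.reindex_bij_betw)
  then have "x ^ (CARD('k) - 1) = 1"
    by (simp add: prod.distrib card_Diff_singleton)
  then show ?thesis
    by (metis One_nat_def Suc_pred mult.right_neutral power_Suc zero_less_card_finite)
qed (simp add: power_0_left)

locale finite_field_hom = field_hom h for h :: "'k::{field,finite} \<Rightarrow> 'c::field"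
begin

lemma of_nat_card_eq_0: "of_nat CARD('k) = (0 :: 'c)"
proof -
  have "bij_betw (\<lambda>x :: 'k. x + 1) UNIV UNIV"
    by (rule bij_betwI[where g = "\<lambda>x. x - 1"]) auto
  then have "(\<Sum>x\<in>UNIV. h (x + 1)) = (\<Sum>x\<in>UNIV. h x)"
    by (rule sum.reindex_bij_betw)
  then show ?thesis
    by (simp add: hom_add sum.distrib)
qed

lemma vanishing_poly_range: "vanishing_poly (range h) = monom 1 CARD('k) - monom 1 1"
proof (rule vanishing_poly_eqI)
  let ?p = "monom 1 CARD('k) - monom 1 1 :: 'c poly"
  have q: "1 < CARD('k)"
    using two_le_card_field[where ?'k = 'k] by simp
  show deg: "degree ?p = card (range h)"
    using q inj_hom by (subst diff_conv_add_uminus, subst degree_add_eq_left)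
      (auto simp: degree_monom_eq card_image)
  show "lead_coeff ?p = 1"
    unfolding deg using q inj_hom by (simp add: card_image)
  show "poly ?p g = 0" if "g \<in> range h" for g
    using that by (auto simp: poly_monom finite_field_power_card simp flip: hom_power)
qed simp

lemma power_card_add: "(x + y :: 'c) ^ CARD('k) = x ^ CARD('k) + y ^ CARD('k)"
proof -
  have power_card: "z ^ CARD('k) = poly (vanishing_poly (range h)) z + z" for z
    by (simp add: vanishing_poly_range poly_monom)
  have "poly (vanishing_poly (range h)) (x + y) =
      poly (vanishing_poly (range h)) x + poly (vanishing_poly (range h)) y"
  proof (rule poly_vanishing_poly_add)
    show "0 \<in> range h"
      by (metis hom_0 rangeI)
  qed (auto simp flip: hom_add hom_minus)
  then show ?thesis
    by (simp add: power_card)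
qed

lemma power_card_power_add:
  "(x + y :: 'c) ^ (CARD('k) ^ i) = x ^ (CARD('k) ^ i) + y ^ (CARD('k) ^ i)"
proof (induction i)
  case (Suc i)
  show ?case
    unfolding power_Suc2 power_mult Suc power_card_add by (rule refl)
qed simp

end

section \<open>Valuations\<close>

locale valued_field =
  fixes w :: "'c::field \<Rightarrow> ereal"
  assumes is_val: "is_valuation w"
begin

lemma w_eq_infinity_iff [simp]: "w x = \<infinity> \<longleftrightarrow> x = 0"
  and w_neq_minf [simp]: "w x \<noteq> -\<infinity>"
  and w_mult: "w (x * y) = w x + w y"
  and w_add_ge: "min (w x) (w y) \<le> w (x + y)"
  using is_val unfolding is_valuation_def by blast+

lemma w_0 [simp]: "w 0 = \<infinity>"
  by simp

lemma w_realE: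
  assumes "x \<noteq> 0"
  obtains v where "w x = ereal v"
  using assms w_eq_infinity_iff[of x] w_neq_minf[of x] by (cases "w x") auto

lemma w_negE:
  assumes "w x < 0"
  obtains v where "w x = ereal v" "v < 0" "x \<noteq> 0"
proof -
  have "x \<noteq> 0"
    using assms by auto
  then obtain v where "w x = ereal v"
    by (rule w_realE)
  then show ?thesis
    using that[of v] assms \<open>x \<noteq> 0\<close> by simp
qed

lemma w_1 [simp]: "w 1 = 0"
proof -
  obtain v where "w 1 = ereal v"
    by (rule w_realE[of 1]) simp_all
  then show ?thesis
    using w_mult[of 1 1] by simp
qed

lemma w_power:
  assumes "x \<noteq> 0"
  shows "w (x ^ n) = ereal (real n) * w x"
proof -
  obtain v where v: "w x = ereal v"
    using assms by (rule w_realE)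
  show ?thesis
    by (induction n) (simp_all add: w_mult v algebra_simps flip: zero_ereal_def)
qed

lemma w_power_nonneg: "0 \<le> w x \<Longrightarrow> 0 \<le> w (x ^ n)"
  by (induction n) (auto simp: w_mult)

lemma w_root_of_unity:
  assumes "x ^ n = 1" and "0 < n"
  shows "w x = 0"
proof -
  have "x \<noteq> 0"
    using assms by (auto simp: power_0_left)
  then obtain v where "w x = ereal v"
    by (rule w_realE)
  then show ?thesis
    using w_power[OF \<open>x \<noteq> 0\<close>, of n] assms by (simp add: zero_ereal_def)
qed

lemma w_minus [simp]: "w (- x) = w x"
  using w_root_of_unity[of "- 1" 2] w_mult[of "- 1" x] by simp

lemma w_diff_commute: "w (x - y) = w (y - x)"
  using w_minus[of "x - y"] by simp

lemma w_diff_ge: "min (w x) (w y) \<le> w (x - y)"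
  using w_add_ge[of x "- y"] by simp

lemma w_add_eq:
  assumes "w x < w y"
  shows "w (x + y) = w x" and "w (y + x) = w x"
proof -
  show left: "w (x + y) = w x"
  proof (rule antisym)
    show "w x \<le> w (x + y)"
      using w_add_ge[of x y] assms by (simp add: min_absorb1)
    show "w (x + y) \<le> w x"
      using w_diff_ge[of "x + y" y] assms by (auto simp: min_def split: if_splits)
  qed
  from left show "w (y + x) = w x"
    by (simp add: add.commute)
qed

lemma w_sum_ge:
  assumes "\<And>i. i \<in> I \<Longrightarrow> B \<le> w (f i)"
  shows "B \<le> w (\<Sum>i\<in>I. f i)"
  using assms
proof (induction I rule: infinite_finite_induct)
  case (insert i I)
  then have "B \<le> min (w (f i)) (w (\<Sum>i\<in>I. f i))"
    by simp
  also have "\<dots> \<le> w (f i + (\<Sum>i\<in>I. f i))"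
    by (rule w_add_ge)
  finally show ?case
    using insert by simp
qed simp_all

lemma w_sum_gt:
  assumes "\<And>i. i \<in> I \<Longrightarrow> B < w (f i)" and "B < \<infinity>"
  shows "B < w (\<Sum>i\<in>I. f i)"
  using assms
proof (induction I rule: infinite_finite_induct)
  case (insert i I)
  then have "B < min (w (f i)) (w (\<Sum>i\<in>I. f i))"
    by simp
  also have "\<dots> \<le> w (f i + (\<Sum>i\<in>I. f i))"
    by (rule w_add_ge)
  finally show ?case
    using insert by simp
qed simp_all

lemma w_prod_le_0: "(\<And>i. i \<in> I \<Longrightarrow> w (f i) \<le> 0) \<Longrightarrow> w (\<Prod>i\<in>I. f i) \<le> 0"
  by (induction I rule: infinite_finite_induct) (auto simp: w_mult intro: add_nonpos_nonpos)

lemma w_prod_eq_0: "(\<And>i. i \<in> I \<Longrightarrow> w (f i) = 0) \<Longrightarrow> w (\<Prod>i\<in>I. f i) = 0"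
  by (induction I rule: infinite_finite_induct) (auto simp: w_mult)

lemma w_divide:
  assumes "y \<noteq> 0"
  shows "w (x / y) = w x - w y"
proof -
  obtain v where v: "w y = ereal v"
    using assms by (rule w_realE)
  have "w x = w (x / y) + w y"
    using assms w_mult[of "x / y" y] by simp
  then show ?thesis
    using v by (cases "w x"; cases "w (x / y)") auto
qed

lemma w_one_minus_divide: "\<mu> \<noteq> 0 \<Longrightarrow> w (1 - z / \<mu>) = w (\<mu> - z) - w \<mu>"
  by (simp add: diff_divide_distrib flip: w_divide)

lemma w_neg_scale_less:
  assumes "w x < 0" and "a < b"
  shows "ereal b * w x < ereal a * w x"
  using assms by (elim w_negE) (simp add: mult_strict_right_mono_neg)

lemma w_neg_scale_neg: "w x < 0 \<Longrightarrow> 0 < a \<Longrightarrow> ereal a * w x < 0"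
  using w_neg_scale_less[of x 0 a] by (simp flip: zero_ereal_def)

lemma val_abs_less_iff:
  assumes "1 \<le> s"
  shows "val_abs w s x < val_abs w s y \<longleftrightarrow> w y < w x"
proof (cases "x = 0 \<or> y = 0")
  case True
  then show ?thesis
    by (auto simp: val_abs_def)
next
  case False
  then obtain a b where ab: "w x = ereal a" "w y = ereal b"
    by (metis w_realE)
  define f where "f c = (if c < 0 then (- c) powr (1 / real s) else - (c powr (1 / real s)))" for c
  have antimono: "f d < f c" if "c < d" for c d
  proof -
    consider "d < 0" | "c < 0" "0 \<le> d" | "0 \<le> c"
      by linarith
    then show ?thesis
    proof cases
      case 2
      then have "f d \<le> 0"
        by (simp add: f_def)
      also have "0 < f c"
        using 2 by (simp add: f_def)
      finally show ?thesis .
    qed (use that assms in \<open>auto simp: f_def intro!: powr_less_mono2\<close>)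
  qed
  have "val_abs w s x = ereal (f a)" "val_abs w s y = ereal (f b)"
    using False ab by (simp_all add: val_abs_def f_def)
  then show ?thesis
    using ab antimono[of a b] antimono[of b a] by (cases a b rule: linorder_cases) auto
qed

lemma val_abs_le_iff:
  assumes "1 \<le> s"
  shows "val_abs w s x \<le> val_abs w s y \<longleftrightarrow> w y \<le> w x"
  using val_abs_less_iff[OF assms, of y x] by (simp flip: not_less)

lemma val_abs_ratio_less:
  assumes "1 \<le> s" and "w x < 0" and "w y < 0"
    and ratio: "val_abs w s x / val_abs w s y < ereal Q"
  shows "ereal (Q ^ s) * w y < w x"
proof -
  obtain a b where ab: "w x = ereal (- a)" "w y = ereal (- b)" "0 < a" "0 < b" "x \<noteq> 0" "y \<noteq> 0"
    using assms(2,3) by (metis w_negE minus_minus neg_0_less_iff_less)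
  have root: "(c powr (1 / real s)) ^ s = c" if "0 < c" for c
    using that assms(1) by (simp add: powr_powr flip: powr_realpow)
  have "a powr (1 / real s) / b powr (1 / real s) < Q"
    using ratio ab by (simp add: val_abs_def)
  then have "a powr (1 / real s) < Q * b powr (1 / real s)"
    using ab by (simp add: field_simps)
  then have "(a powr (1 / real s)) ^ s < (Q * b powr (1 / real s)) ^ s"
    using assms(1) by (intro power_strict_mono) auto
  then have "a < Q ^ s * b"
    using ab by (simp add: root power_mult_distrib)
  then show ?thesis
    using ab by simp
qed

lemma ex_max_w:
  assumes fin: "\<And>B. finite {y \<in> Y. ereal B \<le> w y}" and "Y \<noteq> {}"
  obtains y where "y \<in> Y" "\<And>y'. y' \<in> Y \<Longrightarrow> w y' \<le> w y"
proof (cases "0 \<in> Y")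
  case True
  then show ?thesis
    using that[of 0] by simp
next
  case False
  obtain y0 where "y0 \<in> Y"
    using assms(2) by blast
  moreover from this obtain v where v: "w y0 = ereal v"
    using False w_realE by metis
  ultimately have "y0 \<in> {y \<in> Y. ereal v \<le> w y}"
    by simp
  then obtain y where y: "y \<in> Y" "ereal v \<le> w y" and max: "Max (w ` {y \<in> Y. ereal v \<le> w y}) = w y"
    using obtains_MAX[OF fin[of v], of w] by blast
  have "w y' \<le> w y" if "y' \<in> Y" for y'
  proof (cases "ereal v \<le> w y'")
    case True
    then have "w y' \<in> w ` {y \<in> Y. ereal v \<le> w y}"
      using that by blast
    then show ?thesis
      unfolding max[symmetric] by (intro Max_ge finite_imageI fin)
  qed (use y in auto)
  then show ?thesis
    using that y(1) by blast
qed

end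

section \<open>The exponential of a discrete subgroup\<close>

locale discrete_subgroup = valued_field w for w :: "'c::field \<Rightarrow> ereal" +
  fixes \<Lambda> :: "'c set"
  assumes zero_mem: "0 \<in> \<Lambda>"
    and add_mem: "x \<in> \<Lambda> \<Longrightarrow> y \<in> \<Lambda> \<Longrightarrow> x + y \<in> \<Lambda>"
    and minus_mem: "x \<in> \<Lambda> \<Longrightarrow> - x \<in> \<Lambda>"
    and finite_ball: "finite {x \<in> \<Lambda>. ereal B \<le> w x}"
begin

lemma diff_mem: "x \<in> \<Lambda> \<Longrightarrow> y \<in> \<Lambda> \<Longrightarrow> x - y \<in> \<Lambda>"
  using add_mem[of x "- y"] minus_mem[of y] by simp

lemma ex_nearest:
  obtains \<mu> where "\<mu> \<in> \<Lambda>" "\<And>\<nu>. \<nu> \<in> \<Lambda> \<Longrightarrow> w (z - \<nu>) \<le> w (z - \<mu>)"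
proof -
  let ?Y = "(\<lambda>\<mu>. z - \<mu>) ` \<Lambda>"
  have "finite {y \<in> ?Y. ereal B \<le> w y}" for B
  proof (cases "{y \<in> ?Y. ereal B \<le> w y} = {}")
    case False
    then obtain \<mu> where \<mu>: "\<mu> \<in> \<Lambda>" "ereal B \<le> w (z - \<mu>)"
      by blast
    have "{y \<in> ?Y. ereal B \<le> w y} \<subseteq> (\<lambda>\<nu>. z - \<mu> - \<nu>) ` {\<nu> \<in> \<Lambda>. ereal B \<le> w \<nu>}"
    proof safe
      fix \<nu> assume \<nu>: "\<nu> \<in> \<Lambda>" "ereal B \<le> w (z - \<nu>)"
      have "ereal B \<le> min (w (z - \<mu>)) (w (z - \<nu>))"
        using \<mu> \<nu> by simp
      also have "\<dots> \<le> w ((z - \<mu>) - (z - \<nu>))"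
        by (rule w_diff_ge)
      finally show "z - \<nu> \<in> (\<lambda>\<nu>. z - \<mu> - \<nu>) ` {\<nu> \<in> \<Lambda>. ereal B \<le> w \<nu>}"
        using \<mu>(1) \<nu>(1) by (intro image_eqI[of _ _ "\<nu> - \<mu>"]) (auto intro: diff_mem)
    qed
    then show ?thesis
      using finite_ball[of B] finite_surj by blast
  qed (metis finite.emptyI)
  then obtain y where "y \<in> ?Y" "\<And>y'. y' \<in> ?Y \<Longrightarrow> w y' \<le> w y"
    using ex_max_w[of ?Y] zero_mem by blast
  then show ?thesis
    using that by blast
qed

definition small_disc :: "'c set" where
  "small_disc = {z. \<forall>\<mu>\<in>\<Lambda> - {0}. w \<mu> < w z}"

lemma small_disc_mono: "z \<in> small_disc \<Longrightarrow> w z \<le> w z' \<Longrightarrow> z' \<in> small_disc"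
  by (auto simp: small_disc_def intro: less_le_trans)

lemma small_disc_diff_mem_eq:
  assumes "z \<in> small_disc" and "z' \<in> small_disc" and "z - z' \<in> \<Lambda>"
  shows "z = z'"
proof (rule ccontr)
  assume "z \<noteq> z'"
  then have "w (z - z') < min (w z) (w z')"
    using assms by (auto simp: small_disc_def)
  then show False
    using w_diff_ge[of z z'] by (metis leD)
qed

definition partial_exp :: "'c set \<Rightarrow> 'c \<Rightarrow> 'c" where
  "partial_exp S z = z * (\<Prod>\<mu>\<in>S. 1 - z / \<mu>)"

lemma partial_exp_vanishing_poly:
  assumes "finite S" and "0 \<notin> S"
  shows "partial_exp S z = (\<Prod>\<mu>\<in>S. - 1 / \<mu>) * poly (vanishing_poly (insert 0 S)) z"
proof -
  have "1 - z / \<mu> = (- 1 / \<mu>) * (z - \<mu>)" if "\<mu> \<in> S" for \<mu>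
  proof -
    have "\<mu> \<noteq> 0"
      using that assms(2) by metis
    then show ?thesis
      by (simp add: field_simps)
  qed
  then have "(\<Prod>\<mu>\<in>S. 1 - z / \<mu>) = (\<Prod>\<mu>\<in>S. (- 1 / \<mu>) * (z - \<mu>))"
    by (intro prod.cong refl)
  then have "partial_exp S z = z * ((\<Prod>\<mu>\<in>S. - 1 / \<mu>) * (\<Prod>\<mu>\<in>S. z - \<mu>))"
    unfolding partial_exp_def by (simp only: prod.distrib)
  then show ?thesis
    using assms by (simp add: poly_vanishing_poly mult_ac)
qed

lemma partial_exp_ball_add:
  fixes B :: real
  assumes "B \<le> 0"
  defines "S \<equiv> {x \<in> \<Lambda>. ereal B \<le> w x} - {0}"
  shows "partial_exp S (x + y) = partial_exp S x + partial_exp S y"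
proof -
  let ?G = "{x \<in> \<Lambda>. ereal B \<le> w x}"
  have S: "finite S" "0 \<notin> S" and G: "insert 0 S = ?G"
    using finite_ball[of B] zero_mem by (auto simp: S_def)
  have "poly (vanishing_poly ?G) (x + y) = poly (vanishing_poly ?G) x + poly (vanishing_poly ?G) y"
  proof (rule poly_vanishing_poly_add)
    show "x + y \<in> ?G" if "x \<in> ?G" "y \<in> ?G" for x y
      using that w_add_ge[of x y] by (auto intro: add_mem order_trans[of _ "min (w x) (w y)"])
  qed (use finite_ball[of B] zero_mem minus_mem in auto)
  then show ?thesis
    unfolding partial_exp_vanishing_poly[OF S] G by (simp add: distrib_left)
qed

lemma filterlim_balls:
  "filterlim (\<lambda>n. {x \<in> \<Lambda>. ereal (- real n) \<le> w x} - {0})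
    (finite_subsets_at_top (\<Lambda> - {0})) sequentially"
  unfolding filterlim_finite_subsets_at_top
proof (intro allI impI)
  let ?S = "\<lambda>n. {x \<in> \<Lambda>. ereal (- real n) \<le> w x} - {0}"
  fix X assume X: "finite X \<and> X \<subseteq> \<Lambda> - {0}"
  have "\<forall>\<^sub>F n in sequentially. x \<in> ?S n" if x: "x \<in> X" for x
  proof -
    obtain v where v: "w x = ereal v"
      using w_realE[of x] X x by blast
    have "\<forall>\<^sub>F n in sequentially. - v \<le> real n"
      by (rule eventually_sequentiallyI[of "nat \<lceil>- v\<rceil>"]) linarith
    then show ?thesis
      by eventually_elim (use X x v in auto)
  qed
  then have "\<forall>\<^sub>F n in sequentially. \<forall>x\<in>X. x \<in> ?S n"
    using X by (simp add: eventually_ball_finite)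
  then show "\<forall>\<^sub>F n in sequentially. finite (?S n) \<and> X \<subseteq> ?S n \<and> ?S n \<subseteq> \<Lambda> - {0}"
    by eventually_elim (use finite_ball in auto)
qed

end

locale lattice_exponential = discrete_subgroup w \<Lambda>
  for w :: "'c::field \<Rightarrow> ereal" and \<Lambda> +
  fixes e :: "'c \<Rightarrow> 'c"
  assumes is_exp: "is_lattice_exp w \<Lambda> e"
    and surj_e: "surj e"
    and e_eq_0_iff: "e z = 0 \<longleftrightarrow> z \<in> \<Lambda>"
begin

lemma partial_exp_tendsto:
  "((\<lambda>S. w (e z - partial_exp S z)) \<longlongrightarrow> \<infinity>) (finite_subsets_at_top (\<Lambda> - {0}))"
  using is_exp by (simp add: is_lattice_exp_def partial_exp_def)

lemma e_add: "e (x + y) = e x + e y"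
proof -
  define S where "S n = {x \<in> \<Lambda>. ereal (- real n) \<le> w x} - {0}" for n
  let ?d = "\<lambda>n z. e z - partial_exp (S n) z"
  have close: "\<forall>\<^sub>F n in sequentially. ereal B < w (?d n z)" for B z
    using filterlim_compose[OF partial_exp_tendsto filterlim_balls, of z]
    unfolding tendsto_PInfty S_def by blast
  have "ereal B \<le> w (e (x + y) - (e x + e y))" for B
  proof -
    have "\<forall>\<^sub>F n in sequentially.
        ereal B < w (?d n (x + y)) \<and> ereal B < w (?d n x) \<and> ereal B < w (?d n y)"
      using close by (intro eventually_conj)
    then obtain n
      where n: "ereal B < w (?d n (x + y))" "ereal B < w (?d n x)" "ereal B < w (?d n y)"
      using eventually_happens'[OF sequentially_bot] by blast
    have "ereal B \<le> min (w (?d n (x + y))) (min (w (?d n x)) (w (?d n y)))"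
      using n by (intro min.boundedI less_imp_le)
    also have "\<dots> \<le> min (w (?d n (x + y))) (w (?d n x + ?d n y))"
      by (intro min.mono order_refl w_add_ge)
    also have "\<dots> \<le> w (?d n (x + y) - (?d n x + ?d n y))"
      by (rule w_diff_ge)
    also have "?d n (x + y) - (?d n x + ?d n y) = e (x + y) - (e x + e y)"
      using partial_exp_ball_add[of "- real n" x y] by (simp add: S_def algebra_simps)
    finally show ?thesis .
  qed
  then have "w (e (x + y) - (e x + e y)) = \<infinity>"
    by (rule ereal_top)
  then show ?thesis
    by simp
qed

lemma e_0: "e 0 = 0"
  by (simp add: e_eq_0_iff zero_mem)

lemma e_diff: "e (x - y) = e x - e y"
  using e_add[of "x - y" y] by simp

lemma partial_exp_approx:
  assumes "z \<noteq> 0"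
  obtains S where "S \<subseteq> \<Lambda> - {0}" "w z < w (e z - partial_exp S z)"
proof -
  obtain v where "w z = ereal v"
    using assms by (rule w_realE)
  then obtain X where "finite X" "X \<subseteq> \<Lambda> - {0}"
    and "\<And>Y. finite Y \<Longrightarrow> X \<subseteq> Y \<Longrightarrow> Y \<subseteq> \<Lambda> - {0} \<Longrightarrow> w z < w (e z - partial_exp Y z)"
    using partial_exp_tendsto[of z]
    unfolding tendsto_PInfty eventually_finite_subsets_at_top by metis
  then show ?thesis
    using that[of X] by simp
qed

lemma w_e_small:
  assumes z: "z \<in> small_disc"
  shows "w (e z) = w z"
proof (cases "z = 0")
  case False
  then obtain S where S: "S \<subseteq> \<Lambda> - {0}" "w z < w (e z - partial_exp S z)"
    by (rule partial_exp_approx)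
  have "w (1 - z / \<mu>) = 0" if "\<mu> \<in> S" for \<mu>
  proof -
    have \<mu>: "\<mu> \<noteq> 0" "w \<mu> < w (- z)"
      using that S(1) z by (auto simp: small_disc_def)
    have "w (\<mu> - z) = w \<mu>"
      using w_add_eq(1)[OF \<mu>(2)] by simp
    moreover obtain m where "w \<mu> = ereal m"
      using \<mu>(1) by (rule w_realE)
    ultimately show ?thesis
      using \<mu>(1) by (simp add: w_one_minus_divide)
  qed
  then have "w (\<Prod>\<mu>\<in>S. 1 - z / \<mu>) = 0"
    by (rule w_prod_eq_0)
  then have "w (partial_exp S z) = w z"
    by (simp add: partial_exp_def w_mult)
  then show ?thesis
    using w_add_eq(1)[of "partial_exp S z" "e z - partial_exp S z"] S(2) by simp
qed (simp add: e_0)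

lemma w_e_le_nearest:
  assumes z: "\<And>\<mu>. \<mu> \<in> \<Lambda> \<Longrightarrow> w (z - \<mu>) \<le> w z"
  shows "w (e z) \<le> w z"
proof (cases "z = 0")
  case False
  then obtain S where S: "S \<subseteq> \<Lambda> - {0}" "w z < w (e z - partial_exp S z)"
    by (rule partial_exp_approx)
  have "w (1 - z / \<mu>) \<le> 0" if "\<mu> \<in> S" for \<mu>
  proof -
    have \<mu>: "\<mu> \<noteq> 0" "\<mu> \<in> \<Lambda>"
      using that S(1) by auto
    have "w (\<mu> - z) \<le> w \<mu>"
    proof (cases "w \<mu> < w z")
      case True
      then show ?thesis
        using w_add_eq(1)[of \<mu> "- z"] by simp
    next
      case False
      then show ?thesis
        using z[OF \<mu>(2)] w_diff_commute[of z \<mu>] by simp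
    qed
    moreover obtain m where "w \<mu> = ereal m"
      using \<mu>(1) by (rule w_realE)
    ultimately show ?thesis
      using \<mu>(1) by (cases "w (\<mu> - z)") (simp_all add: w_one_minus_divide)
  qed
  then have "w (\<Prod>\<mu>\<in>S. 1 - z / \<mu>) \<le> 0"
    by (rule w_prod_le_0)
  then have "w (partial_exp S z) \<le> w z"
    unfolding partial_exp_def w_mult by (metis add.right_neutral add_left_mono)
  then show ?thesis
    using w_add_eq(1)[of "partial_exp S z" "e z - partial_exp S z"] S(2) by simp
qed (simp add: e_0)

lemma bij_betw_e_small_disc: "bij_betw e small_disc small_disc"
proof (rule bij_betw_imageI)
  show "inj_on e small_disc"
  proof (rule inj_onI)
    fix y z assume "y \<in> small_disc" "z \<in> small_disc" "e y = e z"
    then show "y = z"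
      by (intro small_disc_diff_mem_eq) (simp_all add: e_diff flip: e_eq_0_iff)
  qed
  show "e ` small_disc = small_disc"
  proof (intro equalityI subsetI)
    fix y assume y: "y \<in> small_disc"
    obtain z where z: "y = e z"
      using surj_e by (metis surjD)
    obtain \<mu> where \<mu>: "\<mu> \<in> \<Lambda>" and nearest: "\<And>\<nu>. \<nu> \<in> \<Lambda> \<Longrightarrow> w (z - \<nu>) \<le> w (z - \<mu>)"
      using ex_nearest by blast
    have "w (z - \<mu> - \<nu>) \<le> w (z - \<mu>)" if "\<nu> \<in> \<Lambda>" for \<nu>
      using nearest[OF add_mem[OF \<mu> that]] by (simp add: diff_diff_eq)
    then have "w (e (z - \<mu>)) \<le> w (z - \<mu>)"
      by (rule w_e_le_nearest)
    moreover have "e (z - \<mu>) = y"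
      using \<mu> by (simp add: e_diff z flip: e_eq_0_iff)
    ultimately show "y \<in> e ` small_disc"
      using small_disc_mono[OF y] by (metis imageI)
  next
    fix y assume "y \<in> e ` small_disc"
    then show "y \<in> small_disc"
      using small_disc_mono w_e_small by auto
  qed
qed

end

section \<open>Linear independence over the polynomial ring\<close>

lemma not_power_dvd_decompose:
  fixes u c :: "'a::comm_semiring_1"
  assumes "\<not> u ^ n dvd c"
  obtains k d where "k < n" "c = u ^ k * d" "\<not> u dvd d"
  using assms
proof (induction n arbitrary: thesis)
  case (Suc n)
  show ?case
  proof (cases "u ^ n dvd c")
    case True
    then obtain d where d: "c = u ^ n * d"
      by (elim dvdE)
    then have "\<not> u dvd d"
      using Suc.prems(2) mult_dvd_mono[OF dvd_refl, of u d "u ^ n"] unfolding d power_Suc2 by blast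
    then show ?thesis
      using Suc.prems(1) d by blast
  next
    case False
    then show ?thesis
      using Suc.IH Suc.prems(1) less_Suc_eq by metis
  qed
qed simp

locale polynomial_action = Modules.module "\<lambda>a. poly (\<rho> a)"
  for \<rho> :: "'k::{field,finite} poly \<Rightarrow> 'c::field poly"
begin

lemma act_zero_if_dvd:
  assumes "x \<in> torsion \<rho> m" and "m dvd c"
  shows "poly (\<rho> c) x = 0"
proof -
  obtain k where "c = k * m"
    using assms(2) by (metis dvdE mult.commute)
  then have "poly (\<rho> c) x = poly (\<rho> k) (poly (\<rho> m) x)"
    by simp
  then show ?thesis
    using assms(1) by (simp add: torsion_def del: scale_scale)
qed

lemma act_mod:
  assumes "x \<in> torsion \<rho> m"
  shows "poly (\<rho> (c mod m)) x = poly (\<rho> c) x"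
proof -
  have "poly (\<rho> (c - c mod m)) x = 0"
    by (rule act_zero_if_dvd[OF assms]) (rule dvd_minus_mod)
  then show ?thesis
    by (simp add: scale_left_diff_distrib)
qed

lemma torsion_mult: "x \<in> torsion \<rho> (m * a) \<longleftrightarrow> poly (\<rho> a) x \<in> torsion \<rho> m"
  by (simp add: torsion_def)

lemma subspace_torsion: "subspace (torsion \<rho> m)"
  unfolding torsion_def by (rule module_hom.subspace_kernel[OF module_hom_scale_self])

lemma span_act_image: "span (poly (\<rho> a) ` S) = poly (\<rho> a) ` span S"
  by (rule module_hom.span_image[OF module_hom_scale_self])

lemma span_family:
  assumes "finite I"
  shows "span (x ` I) = range (\<lambda>c. \<Sum>j\<in>I. poly (\<rho> (c j)) (x j))"
proof
  have "y \<in> range (\<lambda>c. \<Sum>j\<in>I. poly (\<rho> (c j)) (x j))" if "y \<in> span (x ` I)" for y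
    using that
  proof (induction rule: span_induct_alt)
    case base
    show ?case
      by (rule range_eqI[of _ _ "\<lambda>_. 0"]) simp
  next
    case (step a v y)
    then obtain i c where i: "i \<in> I" "v = x i" and y: "y = (\<Sum>j\<in>I. poly (\<rho> (c j)) (x j))"
      by blast
    have "(\<Sum>j\<in>I. poly (\<rho> (if j = i then a else 0)) (x j)) = poly (\<rho> a) v"
      using assms i
      by (simp add: if_distrib[of \<rho>] if_distrib[of "\<lambda>p. poly p _"] sum.delta cong: if_cong)
    then show ?case
      using y by (intro range_eqI[of _ _ "\<lambda>j. (if j = i then a else 0) + c j"])
        (simp add: scale_left_distrib sum.distrib)
  qed
  then show "span (x ` I) \<subseteq> range (\<lambda>c. \<Sum>j\<in>I. poly (\<rho> (c j)) (x j))"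
    by blast
qed (auto intro: span_sum span_scale span_base)

lemma span_torsion_family:
  assumes "finite I" and "m \<noteq> 0" and "\<And>j. j \<in> I \<Longrightarrow> x j \<in> torsion \<rho> m"
  shows "span (x ` I) = (\<lambda>c. \<Sum>j\<in>I. poly (\<rho> (c j)) (x j)) ` (I \<rightarrow>\<^sub>E residues m)"
proof -
  have "(\<Sum>j\<in>I. poly (\<rho> (c j)) (x j)) \<in> (\<lambda>c. \<Sum>j\<in>I. poly (\<rho> (c j)) (x j)) ` (I \<rightarrow>\<^sub>E residues m)" for c
  proof (rule image_eqI)
    show "(\<Sum>j\<in>I. poly (\<rho> (c j)) (x j)) = (\<Sum>j\<in>I. poly (\<rho> (restrict (\<lambda>j. c j mod m) I j)) (x j))"
      using assms(3) by (intro sum.cong) (simp_all add: act_mod)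
    show "restrict (\<lambda>j. c j mod m) I \<in> I \<rightarrow>\<^sub>E residues m"
      using mod_in_residues[OF assms(2)] by auto
  qed
  then show ?thesis
    unfolding span_family[OF assms(1)] by blast
qed

lemma
  assumes "finite I" and "m \<noteq> 0" and "\<And>j. j \<in> I \<Longrightarrow> x j \<in> torsion \<rho> m"
  shows finite_span_torsion_family: "finite (span (x ` I))"
    and card_span_torsion_family_le: "card (span (x ` I)) \<le> card (residues m) ^ card I"
proof -
  have fin: "finite (I \<rightarrow>\<^sub>E residues m)"
    using assms(1) by (intro finite_PiE) auto
  then show "finite (span (x ` I))"
    by (simp add: span_torsion_family[OF assms])
  show "card (span (x ` I)) \<le> card (residues m) ^ card I"
    using card_image_le[OF fin] assms(1) by (simp add: span_torsion_family[OF assms] card_PiE)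
qed

lemma card_span_A_mod_independent:
  assumes "finite I" and "m \<noteq> 0" and "\<And>j. j \<in> I \<Longrightarrow> x j \<in> torsion \<rho> m"
    and indep: "A_mod_independent \<rho> m I x"
  shows "card (span (x ` I)) = card (residues m) ^ card I"
proof -
  have "inj_on (\<lambda>c. \<Sum>j\<in>I. poly (\<rho> (c j)) (x j)) (I \<rightarrow>\<^sub>E residues m)"
  proof (rule inj_onI)
    fix c d assume cd: "c \<in> I \<rightarrow>\<^sub>E residues m" "d \<in> I \<rightarrow>\<^sub>E residues m"
      and eq: "(\<Sum>j\<in>I. poly (\<rho> (c j)) (x j)) = (\<Sum>j\<in>I. poly (\<rho> (d j)) (x j))"
    have "(\<Sum>j\<in>I. poly (\<rho> (c j - d j)) (x j)) = 0"
      using eq by (simp add: scale_left_diff_distrib sum_subtractf)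
    then show "c = d"
      using indep by (intro PiE_residues_eqI[OF cd]) (auto simp: A_mod_independent_def)
  qed
  then show ?thesis
    using assms(1) by (simp add: span_torsion_family[OF assms(1-3)] card_image card_PiE)
qed

lemma A_independent_iff_A_mod_independent_0: "A_independent \<rho> I x \<longleftrightarrow> A_mod_independent \<rho> 0 I x"
  by (simp add: A_independent_def A_mod_independent_def)

lemma A_mod_independent_reindex:
  assumes indep: "A_mod_independent \<rho> m J x" and "inj_on f I" and "f ` I \<subseteq> J" and "finite J"
    and y: "\<And>i. i \<in> I \<Longrightarrow> y i = x (f i)"
  shows "A_mod_independent \<rho> m I y"
  unfolding A_mod_independent_def
proof (intro allI impI ballI)
  fix c i assume sum: "(\<Sum>i\<in>I. poly (\<rho> (c i)) (y i)) = 0" and i: "i \<in> I"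
  define d where "d j = (if j \<in> f ` I then c (inv_into I f j) else 0)" for j
  have "(\<Sum>j\<in>J. poly (\<rho> (d j)) (x j)) = (\<Sum>j\<in>f ` I. poly (\<rho> (d j)) (x j))"
    using assms(3,4) by (intro sum.mono_neutral_right) (auto simp: d_def)
  also have "\<dots> = (\<Sum>i\<in>I. poly (\<rho> (d (f i))) (x (f i)))"
    using assms(2) by (simp add: sum.reindex)
  also have "\<dots> = (\<Sum>i\<in>I. poly (\<rho> (c i)) (y i))"
    using assms(2) y by (intro sum.cong) (auto simp: d_def)
  finally have "m dvd d (f i)"
    using indep sum i assms(3) by (auto simp: A_mod_independent_def)
  then show "m dvd c i"
    using assms(2) i by (simp add: d_def)
qed

lemmas A_independent_reindex =
  A_mod_independent_reindex[of 0, folded A_independent_iff_A_mod_independent_0]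

lemma A_mod_independent_subset:
  "A_mod_independent \<rho> m J x \<Longrightarrow> I \<subseteq> J \<Longrightarrow> finite J \<Longrightarrow> A_mod_independent \<rho> m I x"
  by (rule A_mod_independent_reindex[where f = id]) auto

lemma A_independent_nonzero:
  assumes "A_independent \<rho> I x" and "i \<in> I"
  shows "x i \<noteq> 0"
proof
  assume "x i = 0"
  then have "(\<Sum>j\<in>I. poly (\<rho> (if j = i then 1 else 0)) (x j)) = 0"
    by (intro sum.neutral) auto
  then have "(if i = i then 1 else 0 :: 'k poly) = 0"
    using assms(2) by (intro assms(1)[unfolded A_independent_def, rule_format])
  then show False
    by simp
qed

lemma sum_act_fun_upd:
  assumes "finite I" and "k \<in> I"
  shows "(\<Sum>j\<in>I. poly (\<rho> (c j)) ((x(k := y)) j)) =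
    poly (\<rho> (c k)) y + (\<Sum>j\<in>I - {k}. poly (\<rho> (c j)) (x j))"
  using assms by (auto simp: sum.remove[of I k] intro!: sum.cong)

lemma A_independent_divide:
  assumes indep: "A_independent \<rho> I x" and I: "finite I" "k \<in> I"
    and "u \<noteq> 0" and scalar: "c k \<noteq> 0" and \<mu>: "poly (\<rho> u) \<mu> = (\<Sum>j\<in>I. poly (\<rho> (c j)) (x j))"
  shows "A_independent \<rho> I (x(k := \<mu>))"
  unfolding A_independent_def
proof (intro allI impI)
  fix d assume sum: "(\<Sum>j\<in>I. poly (\<rho> (d j)) ((x(k := \<mu>)) j)) = 0"
  define f where "f = (\<lambda>j. d k * c j + u * (d(k := 0)) j)"
  have "(\<Sum>j\<in>I. poly (\<rho> (f j)) (x j)) =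
      poly (\<rho> (d k)) (\<Sum>j\<in>I. poly (\<rho> (c j)) (x j)) +
      poly (\<rho> u) (\<Sum>j\<in>I. poly (\<rho> ((d(k := 0)) j)) (x j))"
    by (simp only: f_def scale_left_distrib sum.distrib scale_sum_right scale_scale)
  also have "(\<Sum>j\<in>I. poly (\<rho> ((d(k := 0)) j)) (x j)) = (\<Sum>j\<in>I - {k}. poly (\<rho> (d j)) (x j))"
    using I by (auto simp: sum.remove[of I k] intro!: sum.cong)
  also have "poly (\<rho> (d k)) (\<Sum>j\<in>I. poly (\<rho> (c j)) (x j)) + poly (\<rho> u) \<dots> =
      poly (\<rho> u) (poly (\<rho> (d k)) \<mu> + \<dots>)"
    by (simp add: scale_right_distrib mult.commute flip: \<mu>)
  also have "\<dots> = 0"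
    using sum unfolding sum_act_fun_upd[OF I] by simp
  finally have f0: "f j = 0" if "j \<in> I" for j
    using indep that by (auto simp: A_independent_def)
  then have "d k = 0"
    using f0[OF I(2)] scalar by (simp add: f_def)
  moreover from this have "d j = 0" if "j \<in> I" "j \<noteq> k" for j
    using f0[OF that(1)] that(2) \<open>u \<noteq> 0\<close> by (simp add: f_def)
  ultimately show "\<forall>j\<in>I. d j = 0"
    by blast
qed

lemma mem_subspace_if_act_mem:
  assumes u: "prime_elem u" "\<not> u dvd d" and y: "y \<in> torsion \<rho> u" and S: "subspace S"
    and "poly (\<rho> d) y \<in> S"
  shows "y \<in> S"
proof -
  obtain a b where ab: "a * d + b * u = 1"
    using prime_elem_bezout[OF u] .
  have "y = poly (\<rho> (a * d + b * u)) y"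
    by (simp add: ab)
  also have "\<dots> = poly (\<rho> a) (poly (\<rho> d) y)"
    using act_zero_if_dvd[OF y, of "b * u"] by (simp add: scale_left_distrib)
  finally show ?thesis
    using subspace_scale[OF S assms(5), of a] by simp
qed

text \<open>Multiplying the relation by \<open>u\<^bsup>n-k\<^esup>\<close> kills \<open>y\<close>, so every \<open>c\<^sub>j\<close> is divisible by \<open>u\<^sup>k\<close>.\<close>

lemma A_mod_independent_relation_power:
  assumes u: "u \<noteq> 0" and k: "k < n" and indep: "A_mod_independent \<rho> (u ^ n) I x"
    and y: "y \<in> torsion \<rho> (u ^ n)"
    and rel: "poly (\<rho> (u ^ k * d)) y + (\<Sum>j\<in>I. poly (\<rho> (c j)) (x j)) = 0"
  shows "poly (\<rho> d) (poly (\<rho> (u ^ (n - 1))) y) \<in> span (poly (\<rho> (u ^ (n - 1))) ` x ` I)"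
proof -
  have pow: "u ^ n = u ^ (n - k) * u ^ k" "u ^ (n - 1) = u ^ (n - 1 - k) * u ^ k"
    using k by (simp_all flip: power_add)
  have "poly (\<rho> (u ^ (n - k) * (u ^ k * d))) y = 0"
    by (intro act_zero_if_dvd[OF y]) (simp add: pow(1))
  then have "(\<Sum>j\<in>I. poly (\<rho> (u ^ (n - k) * c j)) (x j)) = 0"
    using arg_cong[OF rel, of "poly (\<rho> (u ^ (n - k)))"]
    by (simp add: scale_right_distrib scale_sum_right)
  then have "u ^ n dvd u ^ (n - k) * c j" if "j \<in> I" for j
    using that indep[unfolded A_mod_independent_def, rule_format, of "\<lambda>j. u ^ (n - k) * c j"]
    by blast
  then have "\<forall>j\<in>I. \<exists>b. c j = u ^ k * b"
    using u unfolding pow(1) by (auto simp: dvd_def)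
  then obtain b where b: "\<And>j. j \<in> I \<Longrightarrow> c j = u ^ k * b j"
    by metis
  define v where "v = (\<Sum>j\<in>I. poly (\<rho> (b j)) (x j))"
  have "poly (\<rho> (u ^ k)) (poly (\<rho> d) y + v) = 0"
    using rel b by (simp add: v_def scale_right_distrib scale_sum_right)
  then have "poly (\<rho> (u ^ (n - 1))) (poly (\<rho> d) y + v) = 0"
    unfolding pow(2) by (simp flip: scale_scale)
  then have "poly (\<rho> d) (poly (\<rho> (u ^ (n - 1))) y) = poly (\<rho> (u ^ (n - 1))) (- v)"
    by (simp add: scale_right_distrib eq_neg_iff_add_eq_0 mult.commute)
  also have "\<dots> \<in> span (poly (\<rho> (u ^ (n - 1))) ` x ` I)"
    unfolding span_act_image v_def by (intro imageI span_neg span_sum span_scale span_base) auto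
  finally show ?thesis .
qed

lemma A_mod_independent_insert:
  assumes u: "prime_elem u" and n: "0 < n" and I: "finite I" "i \<notin> I"
    and indep: "A_mod_independent \<rho> (u ^ n) I x" and y: "y \<in> torsion \<rho> (u ^ n)"
    and new: "poly (\<rho> (u ^ (n - 1))) y \<notin> poly (\<rho> (u ^ (n - 1))) ` span (x ` I)"
  shows "A_mod_independent \<rho> (u ^ n) (insert i I) (x(i := y))"
  unfolding A_mod_independent_def
proof (intro allI impI)
  fix c assume "(\<Sum>j\<in>insert i I. poly (\<rho> (c j)) ((x(i := y)) j)) = 0"
  then have rel: "poly (\<rho> (c i)) y + (\<Sum>j\<in>I. poly (\<rho> (c j)) (x j)) = 0"
    using I by (subst (asm) sum_act_fun_upd) auto
  have "u ^ n dvd c i"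
  proof (rule ccontr)
    assume "\<not> u ^ n dvd c i"
    then obtain k d where k: "k < n" and ci: "c i = u ^ k * d" and d: "\<not> u dvd d"
      by (rule not_power_dvd_decompose)
    have "poly (\<rho> d) (poly (\<rho> (u ^ (n - 1))) y) \<in> span (poly (\<rho> (u ^ (n - 1))) ` x ` I)"
      using u rel by (intro A_mod_independent_relation_power[OF _ k indep y]) (auto simp: ci)
    moreover have "poly (\<rho> (u ^ (n - 1))) y \<in> torsion \<rho> u"
      using y n by (simp flip: torsion_mult power_Suc)
    ultimately show False
      using new[folded span_act_image] mem_subspace_if_act_mem[OF u d _ subspace_span] by blast
  qed
  moreover from this have "(\<Sum>j\<in>I. poly (\<rho> (c j)) (x j)) = 0"
    using rel act_zero_if_dvd[OF y] by simp
  ultimately show "\<forall>j\<in>insert i I. u ^ n dvd c j"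
    using indep by (auto simp: A_mod_independent_def)
qed

lemma torsion_SMB_maximal:
  assumes smb: "torsion_SMB w \<rho> r (u ^ n) x" and u: "prime_elem u" and n: "0 < n"
    and i: "i \<in> {1..r}" and y: "y \<in> torsion \<rho> (u ^ n)" and "w (x i) < w y"
  shows "poly (\<rho> (u ^ (n - 1))) y \<in> poly (\<rho> (u ^ (n - 1))) ` span (x ` {1..<i})"
proof (rule ccontr)
  assume new: "\<not> ?thesis"
  have I: "{1..i} = insert i {1..<i}"
    using i by auto
  have "A_mod_independent \<rho> (u ^ n) {1..i} x"
    using smb i by (simp add: torsion_SMB_def)
  then have "A_mod_independent \<rho> (u ^ n) {1..<i} x"
    by (rule A_mod_independent_subset) auto
  then have "A_mod_independent \<rho> (u ^ n) {1..i} (x(i := y))"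
    unfolding I by (intro A_mod_independent_insert u n y new) auto
  then show False
    using smb i y \<open>w (x i) < w y\<close> by (auto simp: torsion_SMB_def not_le[symmetric])
qed

lemma A_mod_independent_quotient:
  assumes fin: "finite I" "finite J" and "I \<inter> J = {}" and indep: "A_mod_independent \<rho> m (I \<union> J) x"
    and spanned: "torsion \<rho> m \<subseteq> span (x ` I)"
  shows "A_mod_independent \<rho> m J (\<lambda>j. poly (\<rho> m) (x j))"
  unfolding A_mod_independent_def
proof (intro allI impI)
  fix c assume "(\<Sum>j\<in>J. poly (\<rho> (c j)) (poly (\<rho> m) (x j))) = 0"
  then have "(\<Sum>j\<in>J. poly (\<rho> (c j)) (x j)) \<in> torsion \<rho> m"
    by (simp add: torsion_def scale_sum_right mult.commute)
  then obtain d where d: "(\<Sum>j\<in>J. poly (\<rho> (c j)) (x j)) = (\<Sum>j\<in>I. poly (\<rho> (d j)) (x j))"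
    using spanned span_family[OF fin(1), of x] by blast
  define f where "f j = (if j \<in> J then c j else - d j)" for j
  have "(\<Sum>j\<in>I \<union> J. poly (\<rho> (f j)) (x j)) =
      (\<Sum>j\<in>I. poly (\<rho> (f j)) (x j)) + (\<Sum>j\<in>J. poly (\<rho> (f j)) (x j))"
    using assms(1-3) by (rule sum.union_disjoint)
  also have "(\<Sum>j\<in>I. poly (\<rho> (f j)) (x j)) = (\<Sum>j\<in>I. - poly (\<rho> (d j)) (x j))"
    using assms(3) by (intro sum.cong) (auto simp: f_def)
  also have "\<dots> + (\<Sum>j\<in>J. poly (\<rho> (f j)) (x j)) = 0"
    using d by (simp add: f_def sum_negf)
  finally have "\<forall>j\<in>I \<union> J. m dvd f j"
    using indep unfolding A_mod_independent_def by blast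
  then show "\<forall>j\<in>J. m dvd c j"
    unfolding f_def by (metis UnI2)
qed

lemma A_mod_independent_imp_A_independent:
  assumes indep: "A_mod_independent \<rho> m I x" and m: "0 < degree m"
    and torsion_free: "\<And>y. y \<in> span (x ` I) \<Longrightarrow> poly (\<rho> m) y = 0 \<Longrightarrow> y = 0"
  shows "A_independent \<rho> I x"
  unfolding A_independent_def
proof (intro allI impI ballI)
  have dvd: "\<forall>j\<in>I. m ^ k dvd c j" if "(\<Sum>j\<in>I. poly (\<rho> (c j)) (x j)) = 0" for c k
    using that
  proof (induction k arbitrary: c)
    case (Suc k)
    then have "\<forall>j\<in>I. \<exists>d. c j = m * d"
      using indep by (auto simp: A_mod_independent_def dvd_def)
    then obtain d where d: "\<And>j. j \<in> I \<Longrightarrow> c j = m * d j"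
      by metis
    have "poly (\<rho> m) (\<Sum>j\<in>I. poly (\<rho> (d j)) (x j)) = (\<Sum>j\<in>I. poly (\<rho> (c j)) (x j))"
      unfolding scale_sum_right using d by (intro sum.cong) auto
    then have "poly (\<rho> m) (\<Sum>j\<in>I. poly (\<rho> (d j)) (x j)) = 0"
      using Suc.prems by simp
    then have "(\<Sum>j\<in>I. poly (\<rho> (d j)) (x j)) = 0"
      by (rule torsion_free[rotated]) (intro span_sum span_scale span_base imageI)
    then show ?case
      using Suc.IH d by simp
  qed simp
  fix c j assume "(\<Sum>j\<in>I. poly (\<rho> (c j)) (x j)) = 0" and j: "j \<in> I"
  then have "m ^ Suc (degree (c j)) dvd c j"
    using dvd by blast
  moreover have "degree (c j) < degree (m ^ Suc (degree (c j)))"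
    using m mult_le_mono2[of 1 "degree m" "Suc (degree (c j))"] by (subst degree_power_eq) auto
  ultimately show "c j = 0"
    using dvd_imp_degree_le[of _ "c j"] by (metis not_less)
qed

end

section \<open>Drinfeld modules\<close>

locale drinfeld =
  fixes \<iota> :: "'k::{field,finite} poly fract \<Rightarrow> 'c::alg_closed_field"
    and K :: "'c set" and s :: nat and \<psi> :: "'k poly \<Rightarrow> 'c poly"
  assumes is_hom: "is_field_hom \<iota>"
    and is_drinfeld_module: "drinfeld_module \<iota> K s \<psi>"
begin

lemma q_ge_2: "2 \<le> CARD('k)"
  by (rule two_le_card_field)

lemma q_power_gt_0 [simp]: "0 < CARD('k) ^ i"
  by (rule zero_less_power) (rule zero_less_card_finite)

lemma rank_pos: "1 \<le> s"
  using is_drinfeld_module by (simp add: drinfeld_module_def)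

lemma q_power_rank_gt_1: "0 < d \<Longrightarrow> 1 < CARD('k) ^ (s * d)"
  using rank_pos q_ge_2 by (intro one_less_power) auto

sublocale iota: field_hom \<iota>
  by unfold_locales (rule is_hom)

sublocale const: finite_field_hom "\<lambda>c :: 'k. \<iota> (to_fract [:c:])"
proof
  have "to_fract [:x * y :: 'k:] = to_fract [:x:] * to_fract [:y:]" for x y
    by (simp flip: to_fract_mult)
  moreover have "to_fract [:x + y :: 'k:] = to_fract [:x:] + to_fract [:y:]" for x y
    by (simp flip: to_fract_add)
  moreover have "to_fract [:1 :: 'k:] = 1"
    by (simp flip: one_pCons)
  ultimately show "is_field_hom (\<lambda>c :: 'k. \<iota> (to_fract [:c:]))"
    by (simp add: is_field_hom_def iota.hom_add iota.hom_mult)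
qed

lemma psi_add: "\<psi> (a + b) = \<psi> a + \<psi> b"
  and psi_mult: "\<psi> (a * b) = pcompose (\<psi> a) (\<psi> b)"
  and psi_const: "\<psi> [:c:] = [:0, \<iota> (to_fract [:c:]):]"
  and psi_t: "\<psi> [:0, 1:] = (\<Sum>i\<le>s. monom (dm_coeff \<psi> i) (CARD('k) ^ i))"
  and dm_coeff_0: "dm_coeff \<psi> 0 = \<iota> (to_fract [:0, 1:])"
  and dm_coeff_rank: "dm_coeff \<psi> s \<noteq> 0"
  using is_drinfeld_module unfolding drinfeld_module_def by blast+

lemma psi_0: "\<psi> 0 = 0"
  using psi_const[of 0] by simp

lemma psi_pCons: "\<psi> (pCons c a) = [:0, \<iota> (to_fract [:c:]):] + pcompose (\<psi> [:0, 1:]) (\<psi> a)"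
proof -
  have "pCons c a = [:c:] + [:0, 1:] * a"
    by simp
  then show ?thesis
    by (metis psi_add psi_mult psi_const)
qed

lemma act_t: "poly (\<psi> [:0, 1:]) x = (\<Sum>i\<le>s. dm_coeff \<psi> i * x ^ (CARD('k) ^ i))"
  by (simp add: psi_t poly_sum poly_monom)

lemma act_pCons:
  "poly (\<psi> (pCons c a)) x = \<iota> (to_fract [:c:]) * x + poly (\<psi> [:0, 1:]) (poly (\<psi> a) x)"
  by (simp add: psi_pCons[of c a] poly_pcompose mult.commute)

lemma act_add: "poly (\<psi> a) (x + y) = poly (\<psi> a) x + poly (\<psi> a) y"
proof (induction a)
  case (pCons c a)
  have "poly (\<psi> [:0, 1:]) (x + y) = poly (\<psi> [:0, 1:]) x + poly (\<psi> [:0, 1:]) y" for x y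
    by (simp add: act_t const.power_card_power_add distrib_left sum.distrib)
  with pCons show ?case
    by (simp add: act_pCons[of c a] distrib_left)
qed (simp add: psi_0)

sublocale psi: polynomial_action \<psi>
proof
  show "poly (\<psi> 1) x = x" for x
    by (simp add: one_pCons psi_const)
qed (simp_all add: act_add psi_add psi_mult poly_pcompose)

lemma degree_psi_t: "degree (\<psi> [:0, 1:]) = CARD('k) ^ s"
proof (rule antisym)
  show "degree (\<psi> [:0, 1:]) \<le> CARD('k) ^ s"
    unfolding psi_t
  proof (rule degree_sum_le)
    fix i assume "i \<in> {..s}"
    then have "CARD('k) ^ i \<le> CARD('k) ^ s"
      using q_ge_2 by (intro power_increasing) auto
    then show "degree (monom (dm_coeff \<psi> i) (CARD('k) ^ i)) \<le> CARD('k) ^ s"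
      using degree_monom_le[of "dm_coeff \<psi> i" "CARD('k) ^ i"] by simp
  qed simp
  show "CARD('k) ^ s \<le> degree (\<psi> [:0, 1:])"
    using dm_coeff_rank unfolding dm_coeff_def by (rule le_degree)
qed

lemma degree_psi: "a \<noteq> 0 \<Longrightarrow> degree (\<psi> a) = CARD('k) ^ (s * degree a)"
proof (induction a)
  case (pCons c a)
  show ?case
  proof (cases "a = 0")
    case True
    then show ?thesis
      using pCons.prems const.hom_eq_0_iff[of c] by (simp add: psi_const)
  next
    case False
    have deg: "degree (pcompose (\<psi> [:0, 1:]) (\<psi> a)) = CARD('k) ^ (s * degree (pCons c a))"
      using False pCons.IH by (simp add: degree_pcompose degree_psi_t power_add)
    have "degree [:0, \<iota> (to_fract [:c:]):] < degree (pcompose (\<psi> [:0, 1:]) (\<psi> a))"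
      unfolding deg using False q_power_rank_gt_1[of "degree (pCons c a)"]
      by (auto intro: le_less_trans[of _ 1])
    then show ?thesis
      unfolding psi_pCons[of c a] using deg by (subst degree_add_eq_right) auto
  qed
qed simp

lemma pderiv_psi_t: "pderiv (\<psi> [:0, 1:]) = [:\<iota> (to_fract [:0, 1:]):]"
proof -
  have pderiv_q_power: "pderiv (monom b (CARD('k) ^ i)) = (if i = 0 then [:b:] else 0)"
    for b :: 'c and i
    using const.of_nat_card_eq_0 by (cases i) (auto simp: pderiv_monom monom_0)
  have "pderiv (\<Sum>i\<in>I. f i) = (\<Sum>i\<in>I. pderiv (f i))" for I :: "nat set" and f :: "nat \<Rightarrow> 'c poly"
    by (induction I rule: infinite_finite_induct) (simp_all add: pderiv_add)
  then have "pderiv (\<psi> [:0, 1:]) = (\<Sum>i\<le>s. if i = 0 then [:dm_coeff \<psi> i:] else 0)"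
    by (simp add: psi_t pderiv_q_power)
  also have "\<dots> = [:\<iota> (to_fract [:0, 1:]):]"
    by (simp add: dm_coeff_0)
  finally show ?thesis .
qed

lemma pderiv_psi: "pderiv (\<psi> a) = [:\<iota> (to_fract a):]"
proof (induction a)
  case (pCons c a)
  have "to_fract (pCons c a) = to_fract [:c:] + to_fract [:0, 1:] * to_fract a"
    by (simp flip: to_fract_add to_fract_mult)
  then show ?case
    by (simp add: psi_pCons[of c a] pderiv_add pderiv_pCons pderiv_pcompose pderiv_psi_t pCons
        iota.hom_add iota.hom_mult mult.commute)
qed (simp add: psi_0)

lemma
  assumes "a \<noteq> 0"
  shows finite_torsion: "finite (torsion \<psi> a)"
    and card_torsion: "card (torsion \<psi> a) = card (residues a) ^ s"
proof -
  have nz: "\<psi> a \<noteq> 0"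
    using degree_psi[OF assms] q_power_gt_0[of "s * degree a"] by (metis degree_0 less_irrefl)
  then show "finite (torsion \<psi> a)"
    unfolding torsion_def by (rule poly_roots_finite)
  have "rsquarefree (\<psi> a)"
    using nz assms by (intro rsquarefreeI_pderiv) (simp_all add: pderiv_psi)
  then show "card (torsion \<psi> a) = card (residues a) ^ s"
    unfolding torsion_def card_residues using assms
    by (simp add: card_roots_rsquarefree degree_psi mult.commute[of s] flip: power_mult)
qed

lemma span_eq_torsion:
  assumes "a \<noteq> 0" and I: "finite I" "card I = s"
    and x: "\<And>i. i \<in> I \<Longrightarrow> x i \<in> torsion \<psi> a" and indep: "A_mod_independent \<psi> a I x"
  shows "psi.span (x ` I) = torsion \<psi> a"
proof (rule card_subset_eq)
  show "finite (torsion \<psi> a)"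
    by (rule finite_torsion[OF assms(1)])
  show "psi.span (x ` I) \<subseteq> torsion \<psi> a"
    using x by (intro psi.span_minimal psi.subspace_torsion) auto
  show "card (psi.span (x ` I)) = card (torsion \<psi> a)"
    using psi.card_span_A_mod_independent[OF I(1) assms(1) x indep] I(2) card_torsion[OF assms(1)]
    by simp
qed

lemma act_surj:
  assumes "a \<noteq> 0"
  obtains z where "poly (\<psi> a) z = y"
proof -
  have "0 < degree (\<psi> a)"
    by (simp add: degree_psi assms)
  then have "0 < degree (\<psi> a + [:- y:])"
    by (subst degree_add_eq_left) auto
  then obtain z where "poly (\<psi> a + [:- y:]) z = 0"
    using alg_closed_imp_poly_has_root by blast
  then show ?thesis
    by (intro that[of z]) simp
qed

end

locale good_drinfeld_module = drinfeld \<iota> K s \<psi> + valued_field w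
  for \<iota> :: "'k::{field,finite} poly fract \<Rightarrow> 'c::alg_closed_field" and w K s \<psi> +
  assumes t_integral: "0 \<le> w (\<iota> (to_fract [:0, 1:]))"
    and good: "good_reduction w s \<psi>"
begin

lemma w_const: "c \<noteq> 0 \<Longrightarrow> w (\<iota> (to_fract [:c:])) = 0"
proof (rule w_root_of_unity)
  assume "c \<noteq> 0"
  then have "c ^ (CARD('k) - 1) = 1"
    using finite_field_power_card[of c] power_minus_mult[of "CARD('k)" c] by simp
  then show "\<iota> (to_fract [:c:]) ^ (CARD('k) - 1) = 1"
    by (simp flip: const.hom_power)
qed (use q_ge_2 in simp)

lemma w_const_nonneg: "0 \<le> w (\<iota> (to_fract [:c:]))"
  by (cases "c = 0") (simp_all add: w_const)

lemma w_dm_coeff_rank: "w (dm_coeff \<psi> s) = 0"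
  using good by (simp add: good_reduction_def stable_reduction_def)

lemma w_dm_coeff_nonneg: "i \<le> s \<Longrightarrow> 0 \<le> w (dm_coeff \<psi> i)"
  using good t_integral
  by (cases "i = 0") (simp_all add: good_reduction_def stable_reduction_def dm_coeff_0)

lemma w_act_t_nonneg: "0 \<le> w x \<Longrightarrow> 0 \<le> w (poly (\<psi> [:0, 1:]) x)"
  unfolding act_t by (rule w_sum_ge) (simp add: w_mult w_dm_coeff_nonneg w_power_nonneg)

lemma w_act_t_neg:
  assumes "w x < 0"
  shows "w (poly (\<psi> [:0, 1:]) x) = ereal (real (CARD('k) ^ s)) * w x"
proof -
  have "x \<noteq> 0"
    using assms by auto
  then have w_power_q: "w (x ^ (CARD('k) ^ i)) = ereal (real (CARD('k) ^ i)) * w x" for i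
    by (rule w_power)
  have lead: "w (dm_coeff \<psi> s * x ^ (CARD('k) ^ s)) = ereal (real (CARD('k) ^ s)) * w x"
    by (simp only: w_mult w_power_q w_dm_coeff_rank add_0)
  also have "\<dots> < w (\<Sum>i<s. dm_coeff \<psi> i * x ^ (CARD('k) ^ i))"
  proof (rule w_sum_gt)
    fix i assume i: "i \<in> {..<s}"
    then have "real (CARD('k) ^ i) < real (CARD('k) ^ s)"
      unfolding of_nat_less_iff using q_ge_2 by (intro power_strict_increasing) auto
    then have "ereal (real (CARD('k) ^ s)) * w x < w (x ^ (CARD('k) ^ i))"
      unfolding w_power_q by (rule w_neg_scale_less[OF assms])
    also have "\<dots> \<le> w (dm_coeff \<psi> i * x ^ (CARD('k) ^ i))"
      using w_dm_coeff_nonneg[of i] i by (simp add: w_mult add_increasing)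
    finally show "ereal (real (CARD('k) ^ s)) * w x < w (dm_coeff \<psi> i * x ^ (CARD('k) ^ i))" .
  next
    have "ereal (real (CARD('k) ^ s)) * w x < 0"
      by (rule w_neg_scale_neg[OF assms]) simp
    then show "ereal (real (CARD('k) ^ s)) * w x < \<infinity>"
      by (rule less_trans) simp
  qed
  finally have "w (dm_coeff \<psi> s * x ^ (CARD('k) ^ s) + (\<Sum>i<s. dm_coeff \<psi> i * x ^ (CARD('k) ^ i))) =
      w (dm_coeff \<psi> s * x ^ (CARD('k) ^ s))"
    by (rule w_add_eq(1))
  then show ?thesis
    unfolding lead by (simp add: act_t lessThan_Suc_atMost[symmetric] add.commute)
qed

lemma w_act_nonneg: "0 \<le> w x \<Longrightarrow> 0 \<le> w (poly (\<psi> a) x)"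
proof (induction a)
  case (pCons c a)
  then have "0 \<le> w (\<iota> (to_fract [:c:]) * x)"
    by (simp add: w_mult w_const_nonneg)
  moreover have "0 \<le> w (poly (\<psi> [:0, 1:]) (poly (\<psi> a) x))"
    using pCons by (intro w_act_t_nonneg)
  ultimately show ?case
    unfolding act_pCons[of c a] by (rule order_trans[OF min.boundedI w_add_ge])
qed simp

lemma w_act_neg:
  assumes neg: "w x < 0" and "a \<noteq> 0"
  shows "w (poly (\<psi> a) x) = ereal (real (CARD('k) ^ (s * degree a))) * w x"
  using assms(2)
proof (induction a)
  case (pCons c a)
  show ?case
  proof (cases "a = 0")
    case True
    then show ?thesis
      using pCons.prems by (simp add: act_pCons[of c 0] w_mult w_const)
  next
    case False
    let ?d = "s * degree (pCons c a)"
    have IH: "w (poly (\<psi> a) x) = ereal (real (CARD('k) ^ (s * degree a))) * w x"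
      using False by (rule pCons.IH)
    then have "w (poly (\<psi> a) x) < 0"
      using w_neg_scale_neg[OF neg, of "real (CARD('k) ^ (s * degree a))"] by simp
    then have "w (poly (\<psi> [:0, 1:]) (poly (\<psi> a) x)) =
        (ereal (real (CARD('k) ^ s)) * ereal (real (CARD('k) ^ (s * degree a)))) * w x"
      unfolding mult.assoc IH[symmetric] by (rule w_act_t_neg)
    also have "ereal (real (CARD('k) ^ s)) * ereal (real (CARD('k) ^ (s * degree a))) =
        ereal (real (CARD('k) ^ ?d))"
      using False by (simp add: power_add)
    finally have lead: "w (poly (\<psi> [:0, 1:]) (poly (\<psi> a) x)) = ereal (real (CARD('k) ^ ?d)) * w x" .
    also have "\<dots> < ereal (real 1) * w x"
      using False by (intro w_neg_scale_less[OF neg] less_imp_of_nat_less q_power_rank_gt_1) simp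
    also have "\<dots> \<le> w (\<iota> (to_fract [:c:]) * x)"
      using w_const_nonneg by (simp add: w_mult add_increasing)
    finally show ?thesis
      unfolding act_pCons[of c a] using lead by (simp add: w_add_eq(2))
  qed
qed simp

lemma w_act_less_0_iff:
  assumes "a \<noteq> 0"
  shows "w (poly (\<psi> a) x) < 0 \<longleftrightarrow> w x < 0"
proof (cases "w x < 0")
  case True
  then show ?thesis
    using w_neg_scale_neg[OF True, of "real (CARD('k) ^ (s * degree a))"]
    by (simp add: w_act_neg assms)
next
  case False
  then show ?thesis
    using w_act_nonneg[of x a] by (simp add: leD)
qed

lemma w_torsion_nonneg: "z \<in> torsion \<psi> a \<Longrightarrow> a \<noteq> 0 \<Longrightarrow> 0 \<le> w z"
  using w_act_less_0_iff[of a z] by (auto simp: torsion_def not_less)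

lemma w_act_less_iff:
  assumes "a \<noteq> 0" and "w x < 0"
  shows "w (poly (\<psi> a) x) < w (poly (\<psi> a) y) \<longleftrightarrow> w x < w y"
proof (cases "w y < 0")
  case True
  let ?Q = "real (CARD('k) ^ (s * degree a))"
  obtain v v' where v: "w x = ereal v" "w y = ereal v'"
    using w_negE[OF assms(2)] w_negE[OF True] by metis
  have "0 < ?Q"
    by simp
  then show ?thesis
    using w_act_neg[OF assms(2,1)] w_act_neg[OF True assms(1)] mult_less_cancel_left_pos[of ?Q v v']
    by (simp add: v)
next
  case False
  then have "w x < w y" "0 \<le> w (poly (\<psi> a) y)" "w (poly (\<psi> a) x) < 0"
    using assms w_act_nonneg[of y a] w_act_less_0_iff[of a x] by auto
  then show ?thesis
    by (metis order_less_le_trans)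
qed

lemma w_act_less_act_residue:
  assumes "a \<noteq> 0" and c: "c \<in> residues a" and x: "w x < 0" and "w x \<le> w y"
  shows "w (poly (\<psi> a) x) < w (poly (\<psi> c) y)"
proof (cases "c \<noteq> 0 \<and> w y < 0")
  case False
  then have "0 \<le> w (poly (\<psi> c) y)"
    using w_act_nonneg[of y c] by auto
  then show ?thesis
    using assms w_act_less_0_iff[of a x] by (metis order_less_le_trans)
next
  case True
  have "w (poly (\<psi> a) x) = ereal (real (CARD('k) ^ (s * degree a))) * w x"
    by (rule w_act_neg[OF x assms(1)])
  also have "\<dots> < ereal (real (CARD('k) ^ (s * degree c))) * w x"
  proof (rule w_neg_scale_less[OF x])
    show "real (CARD('k) ^ (s * degree c)) < real (CARD('k) ^ (s * degree a))"
      unfolding of_nat_less_iff using True c q_ge_2 rank_pos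
      by (intro power_strict_increasing) (auto simp: residues_def)
  qed
  also have "\<dots> \<le> ereal (real (CARD('k) ^ (s * degree c))) * w y"
    using assms(4) by (intro ereal_mult_left_mono) auto
  also have "\<dots> = w (poly (\<psi> c) y)"
    using True by (simp add: w_act_neg)
  finally show ?thesis .
qed

lemma w_act_less_if_val_abs_ratio_less:
  assumes "w x < 0" and "w y < 0" and "a \<noteq> 0"
    and "val_abs w s x / val_abs w s y < ereal (deg_abs a)"
  shows "w (poly (\<psi> a) y) < w x"
proof -
  have "ereal (deg_abs a ^ s) * w y < w x"
    using rank_pos assms(1,2,4) by (rule val_abs_ratio_less)
  then show ?thesis
    using assms(3) by (simp add: w_act_neg[OF assms(2,3)] deg_abs_def mult.commute[of s] power_mult)
qed

end

section \<open>Successive minima of lattices\<close>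

locale drinfeld_lattice = good_drinfeld_module \<iota> w K s \<psi>
  for \<iota> :: "'k::{field,finite} poly fract \<Rightarrow> 'c::alg_closed_field" and w K s \<psi> +
  fixes \<Lambda> :: "'c set"
  assumes subspace_lattice: "psi.subspace \<Lambda>"
    and finite_lattice_ball: "finite {x \<in> \<Lambda>. ereal B \<le> w x}"
    and w_lattice_neg: "\<mu> \<in> \<Lambda> \<Longrightarrow> \<mu> \<noteq> 0 \<Longrightarrow> w \<mu> < 0"
begin

sublocale discrete_subgroup w \<Lambda>
  using psi.subspace_0 psi.subspace_add psi.subspace_neg subspace_lattice finite_lattice_ball
  by unfold_locales blast+

lemma lattice_integral_eq_0: "\<mu> \<in> \<Lambda> \<Longrightarrow> 0 \<le> w \<mu> \<Longrightarrow> \<mu> = 0"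
  using w_lattice_neg[of \<mu>] by (auto simp: leD)

lemma lattice_torsion_free: "\<mu> \<in> \<Lambda> \<Longrightarrow> poly (\<psi> a) \<mu> = 0 \<Longrightarrow> a = 0 \<or> \<mu> = 0"
  using w_lattice_neg[of \<mu>] w_act_less_0_iff[of a \<mu>] by auto

lemma integral_in_small_disc: "0 \<le> w z \<Longrightarrow> z \<in> small_disc"
  using w_lattice_neg by (auto simp: small_disc_def intro: less_le_trans)

lemma torsion_in_small_disc: "z \<in> torsion \<psi> a \<Longrightarrow> a \<noteq> 0 \<Longrightarrow> z \<in> small_disc"
  using w_torsion_nonneg integral_in_small_disc by blast

lemma ex_max_independent_update:
  assumes "y \<in> \<Lambda>" and "A_independent \<psi> I (x(i := y))"
  obtains z where "z \<in> \<Lambda>" "A_independent \<psi> I (x(i := z))"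
    and "\<And>y. y \<in> \<Lambda> \<Longrightarrow> A_independent \<psi> I (x(i := y)) \<Longrightarrow> w y \<le> w z"
proof -
  let ?Y = "{y \<in> \<Lambda>. A_independent \<psi> I (x(i := y))}"
  have "finite {y \<in> ?Y. ereal B \<le> w y}" for B
    by (rule finite_subset[OF _ finite_lattice_ball[of B]]) auto
  moreover have "?Y \<noteq> {}"
    using assms by blast
  ultimately obtain z where "z \<in> ?Y" "\<And>y. y \<in> ?Y \<Longrightarrow> w y \<le> w z"
    using ex_max_w[of ?Y] by blast
  then show ?thesis
    using that[of z] by simp
qed

text \<open>The new lattice vector is the given point of \<open>\<psi>\<^sub>u(\<Lambda>)\<close>, with the scalars reduced modulo \<open>u\<close>,
  divided by \<open>u\<close>.\<close>

lemma lattice_descent: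
  assumes u: "u \<noteq> 0" and I: "finite I" "k \<in> I" and indep: "A_independent \<psi> I x"
    and x: "\<And>j. j \<in> I \<Longrightarrow> x j \<in> \<Lambda>" "\<And>j. j \<in> I \<Longrightarrow> w (x k) \<le> w (x j)"
    and not_dvd: "\<not> u dvd c k" and divisible: "(\<Sum>j\<in>I. poly (\<psi> (c j)) (x j)) \<in> poly (\<psi> u) ` \<Lambda>"
  obtains \<mu> where "\<mu> \<in> \<Lambda>" "A_independent \<psi> I (x(k := \<mu>))" "w (x k) < w \<mu>"
proof -
  obtain \<nu> where \<nu>: "\<nu> \<in> \<Lambda>" "(\<Sum>j\<in>I. poly (\<psi> (c j)) (x j)) = poly (\<psi> u) \<nu>"
    using divisible by blast
  define \<mu> where "\<mu> = \<nu> - (\<Sum>j\<in>I. poly (\<psi> (c j div u)) (x j))"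
  have "poly (\<psi> (c j)) (x j) =
      poly (\<psi> (c j mod u)) (x j) + poly (\<psi> u) (poly (\<psi> (c j div u)) (x j))" for j
    by (simp add: mult.commute flip: psi.scale_left_distrib)
  then have act_\<mu>: "poly (\<psi> u) \<mu> = (\<Sum>j\<in>I. poly (\<psi> (c j mod u)) (x j))"
    by (simp add: \<mu>_def psi.scale_right_diff_distrib psi.scale_sum_right sum.distrib
        del: psi.scale_scale flip: \<nu>(2))
  have neg: "w (x k) < 0"
    using w_lattice_neg x(1)[OF I(2)] psi.A_independent_nonzero[OF indep I(2)] by blast
  have "w (poly (\<psi> u) (x k)) < w (\<Sum>j\<in>I. poly (\<psi> (c j mod u)) (x j))"
  proof (rule w_sum_gt)
    show "w (poly (\<psi> u) (x k)) < w (poly (\<psi> (c j mod u)) (x j))" if "j \<in> I" for j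
      using u neg x(2)[OF that] by (intro w_act_less_act_residue mod_in_residues)
    show "w (poly (\<psi> u) (x k)) < \<infinity>"
      using w_act_less_0_iff[OF u, of "x k"] neg by auto
  qed
  then have "w (x k) < w \<mu>"
    unfolding act_\<mu>[symmetric] using w_act_less_iff[OF u neg] by blast
  moreover have "A_independent \<psi> I (x(k := \<mu>))"
    using not_dvd by (intro psi.A_independent_divide[OF indep I u _ act_\<mu>]) (simp add: dvd_eq_mod_eq_0)
  moreover have "\<mu> \<in> \<Lambda>"
    unfolding \<mu>_def using \<nu>(1) x(1)
    by (intro diff_mem psi.subspace_sum psi.subspace_scale subspace_lattice)
  ultimately show ?thesis
    using that by blast
qed

lemma lattice_descent_update:
  assumes u: "0 < degree u" and I: "finite I" "k \<notin> I"
    and indep: "A_independent \<psi> (insert k I) (x(k := z))"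
    and z: "z \<in> \<Lambda>" and x: "\<And>j. j \<in> I \<Longrightarrow> x j \<in> \<Lambda>" "\<And>j. j \<in> I \<Longrightarrow> w z \<le> w (x j)"
    and \<mu>: "\<mu> \<in> \<Lambda>" "z - poly (\<psi> u) \<mu> \<in> psi.span (x ` I)"
  obtains \<nu> where "\<nu> \<in> \<Lambda>" "A_independent \<psi> (insert k I) (x(k := \<nu>))" "w z < w \<nu>"
proof -
  obtain c where c: "z - poly (\<psi> u) \<mu> = (\<Sum>j\<in>I. poly (\<psi> (c j)) (x j))"
    using \<mu>(2) psi.span_family[OF I(1), of x] by auto
  define d where "d = (\<lambda>j. - c j)(k := 1)"
  have "(\<Sum>j\<in>insert k I. poly (\<psi> (d j)) ((x(k := z)) j)) = z + (\<Sum>j\<in>I. poly (\<psi> (d j)) (x j))"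
    using I psi.sum_act_fun_upd[of "insert k I" k d x z] by (simp add: d_def)
  also have "(\<Sum>j\<in>I. poly (\<psi> (d j)) (x j)) = - (\<Sum>j\<in>I. poly (\<psi> (c j)) (x j))"
    unfolding sum_negf[symmetric] using I(2) by (intro sum.cong) (auto simp: d_def)
  also have "z + \<dots> = poly (\<psi> u) \<mu>"
    by (simp flip: c)
  finally have divisible: "(\<Sum>j\<in>insert k I. poly (\<psi> (d j)) ((x(k := z)) j)) \<in> poly (\<psi> u) ` \<Lambda>"
    using \<mu>(1) by simp
  have not_dvd: "\<not> u dvd d k"
    using u is_unit_iff_degree[of u] by (cases "u = 0") (simp_all add: d_def)
  have mem: "(x(k := z)) j \<in> \<Lambda>" and le: "w ((x(k := z)) k) \<le> w ((x(k := z)) j)"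
    if "j \<in> insert k I" for j
    using that x z by auto
  show ?thesis
  proof (rule lattice_descent[OF _ _ _ indep mem le not_dvd divisible])
    fix \<nu>
    assume "\<nu> \<in> \<Lambda>" "A_independent \<psi> (insert k I) (x(k := z, k := \<nu>))" "w ((x(k := z)) k) < w \<nu>"
    then show ?thesis
      using that by simp
  qed (use u I in auto)
qed

lemma lattice_SMB_iff:
  "lattice_SMB w \<psi> \<Lambda> s r x \<longleftrightarrow>
    (\<forall>i\<in>{s + 1..r}. x i \<in> \<Lambda> \<and> A_independent \<psi> {s + 1..i} x \<and>
      (\<forall>y\<in>\<Lambda>. A_independent \<psi> {s + 1..i} (x(i := y)) \<longrightarrow> w y \<le> w (x i)))"
  using rank_pos by (simp add: lattice_SMB_def val_abs_le_iff)

context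
  fixes r :: nat and x :: "nat \<Rightarrow> 'c"
  assumes smb: "lattice_SMB w \<psi> \<Lambda> s r x"
begin

lemma lattice_SMB_mem: "i \<in> {s + 1..r} \<Longrightarrow> x i \<in> \<Lambda>"
  and lattice_SMB_independent: "i \<in> {s + 1..r} \<Longrightarrow> A_independent \<psi> {s + 1..i} x"
  and lattice_SMB_maximal:
    "i \<in> {s + 1..r} \<Longrightarrow> y \<in> \<Lambda> \<Longrightarrow> A_independent \<psi> {s + 1..i} (x(i := y)) \<Longrightarrow> w y \<le> w (x i)"
  using smb by (simp_all add: lattice_SMB_iff)

lemma lattice_SMB_neg: "i \<in> {s + 1..r} \<Longrightarrow> w (x i) < 0"
  using w_lattice_neg[OF lattice_SMB_mem] psi.A_independent_nonzero[OF lattice_SMB_independent, of i i]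
  by simp

lemma lattice_SMB_antimono:
  assumes "s + 1 \<le> i" and "i \<le> j" and "j \<le> r"
  shows "w (x j) \<le> w (x i)"
proof (rule lattice_SMB_maximal)
  show "A_independent \<psi> {s + 1..i} (x(i := x j))"
    by (rule psi.A_independent_reindex[OF lattice_SMB_independent[of j], where f = "id(i := j)"])
      (use assms in \<open>auto simp: inj_on_def\<close>)
qed (use assms in \<open>auto intro: lattice_SMB_mem\<close>)

lemma lattice_SMB_small_disc_iff:
  assumes "s < r"
  shows "z \<in> small_disc \<longleftrightarrow> w (x (s + 1)) < w z"
proof
  have first: "s + 1 \<in> {s + 1..r}"
    using assms by simp
  show "w (x (s + 1)) < w z" if "z \<in> small_disc"
    using that lattice_SMB_mem[OF first] lattice_SMB_neg[OF first] by (auto simp: small_disc_def)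
  have "w \<mu> \<le> w (x (s + 1))" if "\<mu> \<in> \<Lambda>" "\<mu> \<noteq> 0" for \<mu>
    using that lattice_torsion_free
    by (intro lattice_SMB_maximal[OF first]) (auto simp: A_independent_def)
  then show "z \<in> small_disc" if "w (x (s + 1)) < w z"
    using that by (auto simp: small_disc_def intro: le_less_trans)
qed

lemma lattice_SMB_pure:
  assumes "u \<noteq> 0"
  shows "i \<le> r \<Longrightarrow> (\<Sum>j\<in>{s + 1..i}. poly (\<psi> (c j)) (x j)) \<in> poly (\<psi> u) ` \<Lambda> \<Longrightarrow>
    \<forall>j\<in>{s + 1..i}. u dvd c j"
proof (induction i)
  case (Suc i)
  show ?case
  proof (cases "s + 1 \<le> Suc i")
    case True
    then have i: "Suc i \<in> {s + 1..r}" and I: "{s + 1..Suc i} = insert (Suc i) {s + 1..i}"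
      using Suc.prems(1) by auto
    have dvd: "u dvd c (Suc i)"
    proof (rule ccontr)
      assume "\<not> u dvd c (Suc i)"
      then obtain \<mu>
        where "\<mu> \<in> \<Lambda>" "A_independent \<psi> {s + 1..Suc i} (x(Suc i := \<mu>))" "w (x (Suc i)) < w \<mu>"
        using lattice_descent[OF assms _ _ lattice_SMB_independent[OF i], of "Suc i" c] Suc.prems i
          lattice_SMB_mem lattice_SMB_antimono[of _ "Suc i"] by auto
      then show False
        using lattice_SMB_maximal[OF i] by (meson not_less)
    qed
    then obtain d where d: "c (Suc i) = u * d"
      by (elim dvdE)
    obtain \<nu> where \<nu>: "\<nu> \<in> \<Lambda>" "(\<Sum>j\<in>{s + 1..Suc i}. poly (\<psi> (c j)) (x j)) = poly (\<psi> u) \<nu>"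
      using Suc.prems(2) by blast
    have "poly (\<psi> u) \<nu> =
        poly (\<psi> u) (poly (\<psi> d) (x (Suc i))) + (\<Sum>j\<in>{s + 1..i}. poly (\<psi> (c j)) (x j))"
      using \<nu>(2) unfolding I by (simp add: d)
    then have "(\<Sum>j\<in>{s + 1..i}. poly (\<psi> (c j)) (x j)) = poly (\<psi> u) (\<nu> - poly (\<psi> d) (x (Suc i)))"
      by (simp add: psi.scale_right_diff_distrib)
    moreover have "\<nu> - poly (\<psi> d) (x (Suc i)) \<in> \<Lambda>"
      using \<nu>(1) lattice_SMB_mem[OF i] by (intro diff_mem psi.subspace_scale[OF subspace_lattice])
    ultimately have "\<forall>j\<in>{s + 1..i}. u dvd c j"
      using Suc by auto
    then show ?thesis
      using dvd unfolding I by blast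
  qed simp
qed simp

end

lemma lattice_SMB_if_larger_congruent:
  assumes u: "0 < degree u" and mem: "\<And>i. i \<in> {s + 1..r} \<Longrightarrow> x i \<in> \<Lambda>"
    and indep: "A_independent \<psi> {s + 1..r} x"
    and larger: "\<And>i y. i \<in> {s + 1..r} \<Longrightarrow> y \<in> \<Lambda> \<Longrightarrow> w (x i) < w y \<Longrightarrow>
      \<exists>\<mu>\<in>\<Lambda>. y - poly (\<psi> u) \<mu> \<in> psi.span (x ` {s + 1..<i})"
  shows "lattice_SMB w \<psi> \<Lambda> s r x"
proof -
  have "w y \<le> w (x i)" if "i \<in> {s + 1..r}" "y \<in> \<Lambda>" "A_independent \<psi> {s + 1..i} (x(i := y))" for i y
    using that
  proof (induction i arbitrary: y rule: less_induct)
    case (less i)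
    obtain z where z: "z \<in> \<Lambda>" and indep_z: "A_independent \<psi> {s + 1..i} (x(i := z))"
      and max: "\<And>y. y \<in> \<Lambda> \<Longrightarrow> A_independent \<psi> {s + 1..i} (x(i := y)) \<Longrightarrow> w y \<le> w z"
      using ex_max_independent_update[OF less.prems(2,3)] by blast
    have "w z \<le> w (x i)"
    proof (rule ccontr)
      assume "\<not> w z \<le> w (x i)"
      then obtain \<mu> where \<mu>: "\<mu> \<in> \<Lambda>" "z - poly (\<psi> u) \<mu> \<in> psi.span (x ` {s + 1..<i})"
        using larger[OF less.prems(1) z] not_le by blast
      have I: "{s + 1..i} = insert i {s + 1..<i}"
        using less.prems(1) by auto
      have le: "w z \<le> w (x j)" if j: "j \<in> {s + 1..<i}" for j
      proof (rule less.IH)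
        show "A_independent \<psi> {s + 1..j} (x(j := z))"
          by (rule psi.A_independent_reindex[OF indep_z, of "id(j := i)"])
            (use j in \<open>auto simp: inj_on_def\<close>)
      qed (use j less.prems(1) z in auto)
      obtain \<nu> where "\<nu> \<in> \<Lambda>" "A_independent \<psi> {s + 1..i} (x(i := \<nu>))" "w z < w \<nu>"
        using lattice_descent_update[OF u _ _ indep_z[unfolded I] z _ le \<mu>] mem less.prems(1)
        unfolding I by auto
      then show False
        using max[of \<nu>] by (simp add: not_less[symmetric])
    qed
    then show ?case
      using order_trans[OF max[of y]] less.prems by blast
  qed
  moreover have "A_independent \<psi> {s + 1..i} x" if "i \<le> r" for i
    using that by (intro psi.A_independent_reindex[OF indep, of id]) auto
  ultimately show ?thesis
    using mem by (auto simp: lattice_SMB_iff)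
qed

end

section \<open>Torsion points and the exponential\<close>

locale drinfeld_uniformization = drinfeld_lattice \<iota> w K s \<psi> \<Lambda> + lattice_exponential w \<Lambda> e
  for \<iota> :: "'k::{field,finite} poly fract \<Rightarrow> 'c::alg_closed_field" and w K s \<psi> \<Lambda> e +
  fixes \<phi> :: "'k poly \<Rightarrow> 'c poly"
  assumes e_act: "e (poly (\<psi> a) z) = poly (\<phi> a) (e z)"
begin

sublocale phi: polynomial_action \<phi>
proof
  fix a b :: "'k poly" and x y :: 'c
  obtain z z' where z: "x = e z" "y = e z'"
    using surj_e by (metis surjD)
  show "poly (\<phi> a) (x + y) = poly (\<phi> a) x + poly (\<phi> a) y"
    unfolding z e_add[symmetric] e_act[symmetric] psi.scale_right_distrib ..
  show "poly (\<phi> (a + b)) x = poly (\<phi> a) x + poly (\<phi> b) x"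
    unfolding z e_act[symmetric] psi.scale_left_distrib e_add ..
  show "poly (\<phi> a) (poly (\<phi> b) x) = poly (\<phi> (a * b)) x"
    unfolding z e_act[symmetric] psi.scale_scale ..
  show "poly (\<phi> 1) x = x"
    unfolding z e_act[symmetric] psi.scale_one ..
qed

sublocale exp: module_hom "\<lambda>a. poly (\<psi> a)" "\<lambda>a. poly (\<phi> a)" e
  by unfold_locales (simp_all add: e_add e_act)

lemma e_torsion_iff: "e z \<in> torsion \<phi> a \<longleftrightarrow> poly (\<psi> a) z \<in> \<Lambda>"
  by (simp add: torsion_def flip: e_act e_eq_0_iff)

lemma A_mod_independent_if_exp:
  assumes "A_mod_independent \<phi> m I (\<lambda>j. e (x j))"
  shows "A_mod_independent \<psi> m I x"
  unfolding A_mod_independent_def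
proof (intro allI impI)
  fix c assume "(\<Sum>j\<in>I. poly (\<psi> (c j)) (x j)) = 0"
  then have "(\<Sum>j\<in>I. poly (\<phi> (c j)) (e (x j))) = 0"
    by (simp flip: e_act exp.sum)
  then show "\<forall>j\<in>I. m dvd c j"
    using assms unfolding A_mod_independent_def by blast
qed

lemma A_mod_independent_exp_integral:
  assumes "A_mod_independent \<psi> m I x" and integral: "\<And>j. j \<in> I \<Longrightarrow> 0 \<le> w (x j)"
  shows "A_mod_independent \<phi> m I (\<lambda>j. e (x j))"
  unfolding A_mod_independent_def
proof (intro allI impI)
  fix c assume "(\<Sum>j\<in>I. poly (\<phi> (c j)) (e (x j))) = 0"
  then have "(\<Sum>j\<in>I. poly (\<psi> (c j)) (x j)) \<in> \<Lambda>"
    by (simp flip: e_act exp.sum e_eq_0_iff)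
  moreover have "0 \<le> w (\<Sum>j\<in>I. poly (\<psi> (c j)) (x j))"
    using integral by (intro w_sum_ge w_act_nonneg)
  ultimately have "(\<Sum>j\<in>I. poly (\<psi> (c j)) (x j)) = 0"
    by (rule lattice_integral_eq_0)
  then show "\<forall>j\<in>I. m dvd c j"
    using assms(1) unfolding A_mod_independent_def by blast
qed

lemma inj_on_exp_division_points:
  assumes smb: "lattice_SMB w \<psi> \<Lambda> s r x" and i: "i \<le> r" and a: "a \<noteq> 0"
    and \<zeta>: "\<And>j. j \<in> {s + 1..i} \<Longrightarrow> poly (\<psi> a) (\<zeta> j) = x j"
  shows "inj_on (\<lambda>(c, \<tau>). e ((\<Sum>j\<in>{s + 1..i}. poly (\<psi> (c j)) (\<zeta> j)) + \<tau>))
    (({s + 1..i} \<rightarrow>\<^sub>E residues a) \<times> torsion \<psi> a)"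
proof (rule inj_onI, clarify)
  let ?I = "{s + 1..i}"
  fix c \<tau> c' \<tau>'
  assume c: "c \<in> ?I \<rightarrow>\<^sub>E residues a" "c' \<in> ?I \<rightarrow>\<^sub>E residues a"
    and \<tau>: "\<tau> \<in> torsion \<psi> a" "\<tau>' \<in> torsion \<psi> a"
    and eq: "e ((\<Sum>j\<in>?I. poly (\<psi> (c j)) (\<zeta> j)) + \<tau>) = e ((\<Sum>j\<in>?I. poly (\<psi> (c' j)) (\<zeta> j)) + \<tau>')"
  define \<mu> where "\<mu> = (\<Sum>j\<in>?I. poly (\<psi> (c j - c' j)) (\<zeta> j)) + (\<tau> - \<tau>')"
  have "\<mu> = ((\<Sum>j\<in>?I. poly (\<psi> (c j)) (\<zeta> j)) + \<tau>) - ((\<Sum>j\<in>?I. poly (\<psi> (c' j)) (\<zeta> j)) + \<tau>')"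
    by (simp add: \<mu>_def psi.scale_left_diff_distrib sum_subtractf)
  then have \<mu>: "\<mu> \<in> \<Lambda>"
    using eq by (simp only: e_diff diff_self flip: e_eq_0_iff)
  have tors: "\<tau> - \<tau>' \<in> torsion \<psi> a"
    using \<tau> by (intro psi.subspace_diff psi.subspace_torsion)
  then have "poly (\<psi> a) \<mu> = (\<Sum>j\<in>?I. poly (\<psi> a) (poly (\<psi> (c j - c' j)) (\<zeta> j)))"
    by (simp only: \<mu>_def torsion_def mem_Collect_eq psi.scale_right_distrib psi.scale_sum_right
        add_0_right)
  also have "\<dots> = (\<Sum>j\<in>?I. poly (\<psi> (c j - c' j)) (x j))"
    using \<zeta> by (intro sum.cong) (simp_all only: psi.scale_left_commute[of a])
  finally have "\<forall>j\<in>?I. a dvd c j - c' j"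
    using \<mu> by (intro lattice_SMB_pure[OF smb a i]) (metis imageI)
  then have "c = c'"
    by (rule PiE_residues_eqI[OF c])
  moreover have "\<tau> - \<tau>' = 0"
    using \<mu> w_torsion_nonneg[OF tors a]
    by (intro lattice_integral_eq_0) (simp_all add: \<mu>_def \<open>c = c'\<close>)
  ultimately show "c = c' \<and> \<tau> = \<tau>'"
    by simp
qed

lemma ex_division_point_exp_notin:
  assumes "lattice_SMB w \<psi> \<Lambda> s r x" and "i \<le> r" and a: "a \<noteq> 0"
    and "\<And>j. j \<in> {s + 1..i} \<Longrightarrow> poly (\<psi> a) (\<zeta> j) = x j"
    and U: "phi.subspace U" "finite U" "card U < card (residues a) ^ (s + card {s + 1..i})"
  shows "\<exists>z \<in> torsion \<psi> a \<union> \<zeta> ` {s + 1..i}. e z \<notin> U"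
proof (rule ccontr)
  let ?I = "{s + 1..i}"
  let ?D = "(?I \<rightarrow>\<^sub>E residues a) \<times> torsion \<psi> a"
  let ?f = "\<lambda>(c, \<tau>). e ((\<Sum>j\<in>?I. poly (\<psi> (c j)) (\<zeta> j)) + \<tau>)"
  assume "\<not> ?thesis"
  then have "?f ` ?D \<subseteq> U"
    using U(1) by (auto simp: e_add e_act exp.sum
        intro!: phi.subspace_add phi.subspace_sum phi.subspace_scale)
  then have "card ?D \<le> card U"
    using inj_on_exp_division_points[OF assms(1-4)] U(2) by (intro card_inj_on_le)
  moreover have "card ?D = card (residues a) ^ (s + card ?I)"
    by (simp add: card_cartesian_product card_PiE card_torsion[OF a] power_add)
  ultimately show False
    using U(3) by simp
qed

end

locale torsion_SMB_setting = drinfeld_uniformization \<iota> w K s \<psi> \<Lambda> e \<phi>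
  for \<iota> :: "'k::{field,finite} poly fract \<Rightarrow> 'c::alg_closed_field" and w K s \<psi> \<Lambda> e \<phi> +
  fixes r n :: nat and \<omega>0 lam :: "nat \<Rightarrow> 'c" and u :: "'k poly"
  assumes s_less_r: "s < r"
    and lattice_smb: "lattice_SMB w \<psi> \<Lambda> s r \<omega>0"
    and prime_u: "prime_elem u" and n_pos: "0 < n"
    and division_bound: "w (poly (\<psi> (u ^ n)) (\<omega>0 (s + 1))) < w (\<omega>0 r)"
    and torsion_smb: "torsion_SMB w \<phi> r (u ^ n) lam"
begin

lemma u_neq_0 [simp]: "u \<noteq> 0"
  using prime_u by auto

lemma u_power_eq: "u ^ n = u * u ^ (n - 1)"
  using n_pos by (simp flip: power_Suc)

lemma lam_torsion: "i \<in> {1..r} \<Longrightarrow> lam i \<in> torsion \<phi> (u ^ n)"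
  using torsion_smb by (simp add: torsion_SMB_def)

lemma lam_independent: "A_mod_independent \<phi> (u ^ n) {1..r} lam"
  using torsion_smb s_less_r by (simp add: torsion_SMB_def)

lemma small_disc_eq: "z \<in> small_disc \<longleftrightarrow> w (\<omega>0 (s + 1)) < w z"
  by (rule lattice_SMB_small_disc_iff[OF lattice_smb s_less_r])

lemma lattice_division_point_small:
  assumes "j \<in> {s + 1..r}" and "poly (\<psi> (u ^ n)) z = \<omega>0 j"
  shows "z \<in> small_disc"
proof -
  have "w (poly (\<psi> (u ^ n)) (\<omega>0 (s + 1))) < w (poly (\<psi> (u ^ n)) z)"
    unfolding assms(2) using division_bound lattice_SMB_antimono[OF lattice_smb, of j r] assms(1)
    by (auto intro: less_le_trans)
  then show ?thesis
    using w_act_less_iff[of "u ^ n" "\<omega>0 (s + 1)" z] lattice_SMB_neg[OF lattice_smb, of "s + 1"]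
      s_less_r by (simp add: small_disc_eq)
qed

lemma ex_division_point_new:
  assumes i: "i \<in> {1..r}"
  obtains z where "z \<in> torsion \<psi> (u ^ n) \<or> (\<exists>j\<in>{s + 1..i}. poly (\<psi> (u ^ n)) z = \<omega>0 j)"
    and "poly (\<phi> (u ^ (n - 1))) (e z) \<notin> poly (\<phi> (u ^ (n - 1))) ` phi.span (lam ` {1..<i})"
proof -
  let ?I = "{s + 1..i}" and ?U = "phi.span ((\<lambda>j. poly (\<phi> (u ^ (n - 1))) (lam j)) ` {1..<i})"
  have "\<forall>j. \<exists>z. poly (\<psi> (u ^ n)) z = \<omega>0 j"
    using act_surj[of "u ^ n"] by (metis u_neq_0 power_not_zero)
  then obtain \<zeta> where \<zeta>: "\<And>j. poly (\<psi> (u ^ n)) (\<zeta> j) = \<omega>0 j"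
    by metis
  have U_torsion: "poly (\<phi> (u ^ (n - 1))) (lam j) \<in> torsion \<phi> u" if "j \<in> {1..<i}" for j
    using lam_torsion[of j] that i by (simp add: u_power_eq phi.torsion_mult)
  have "card ?U \<le> card (residues u) ^ (i - 1)"
    using phi.card_span_torsion_family_le[of "{1..<i}", OF _ u_neq_0 U_torsion] by simp
  also have "\<dots> < card (residues u) ^ (s + card ?I)"
    using i
    by (intro power_strict_increasing one_less_card_residues prime_elem_degree_pos prime_u) auto
  finally obtain y where y: "y \<in> torsion \<psi> u \<union> (\<lambda>j. poly (\<psi> (u ^ (n - 1))) (\<zeta> j)) ` ?I" "e y \<notin> ?U"
    using ex_division_point_exp_notin[OF lattice_smb, of i u "\<lambda>j. poly (\<psi> (u ^ (n - 1))) (\<zeta> j)" ?U]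
      phi.finite_span_torsion_family[of "{1..<i}", OF _ u_neq_0 U_torsion] i \<zeta>
    by (auto simp: u_power_eq)
  obtain z where z: "y = poly (\<psi> (u ^ (n - 1))) z"
    and division: "z \<in> torsion \<psi> (u ^ n) \<or> (\<exists>j\<in>?I. poly (\<psi> (u ^ n)) z = \<omega>0 j)"
  proof (cases "y \<in> torsion \<psi> u")
    case True
    obtain z where "poly (\<psi> (u ^ (n - 1))) z = y"
      using act_surj[of "u ^ (n - 1)" y] by auto
    then show ?thesis
      using True that[of z] by (simp add: u_power_eq psi.torsion_mult)
  next
    case False
    then show ?thesis
      using y(1) \<zeta> that by blast
  qed
  have "poly (\<phi> (u ^ (n - 1))) (e z) \<notin> poly (\<phi> (u ^ (n - 1))) ` phi.span (lam ` {1..<i})"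
    using y(2) by (simp add: z e_act image_image flip: phi.span_act_image)
  then show ?thesis
    using that[OF division] by blast
qed

lemma ex_small_division_point_new:
  assumes i: "i \<in> {1..r}"
  obtains z where "z \<in> small_disc" "i \<le> s \<Longrightarrow> 0 \<le> w z" "e z \<in> torsion \<phi> (u ^ n)"
    and "poly (\<phi> (u ^ (n - 1))) (e z) \<notin> poly (\<phi> (u ^ (n - 1))) ` phi.span (lam ` {1..<i})"
proof -
  obtain z where z: "z \<in> torsion \<psi> (u ^ n) \<or> (\<exists>j\<in>{s + 1..i}. poly (\<psi> (u ^ n)) z = \<omega>0 j)"
    and new: "poly (\<phi> (u ^ (n - 1))) (e z) \<notin> poly (\<phi> (u ^ (n - 1))) ` phi.span (lam ` {1..<i})"
    using ex_division_point_new[OF i] .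
  have "z \<in> small_disc"
    using z torsion_in_small_disc[of z "u ^ n"] lattice_division_point_small[of _ z] i by fastforce
  moreover have "i \<le> s \<Longrightarrow> 0 \<le> w z"
    using z w_torsion_nonneg[of z "u ^ n"] by auto
  moreover have "e z \<in> torsion \<phi> (u ^ n)"
    unfolding e_torsion_iff using z lattice_SMB_mem[OF lattice_smb] i zero_mem
    by (auto simp: torsion_def)
  ultimately show ?thesis
    using that new by blast
qed

lemma
  assumes i: "i \<in> {1..r}"
  shows lam_small: "lam i \<in> small_disc" and lam_integral: "i \<le> s \<Longrightarrow> 0 \<le> w (lam i)"
proof -
  obtain z where z: "z \<in> small_disc" "i \<le> s \<Longrightarrow> 0 \<le> w z" "e z \<in> torsion \<phi> (u ^ n)"
    and new: "poly (\<phi> (u ^ (n - 1))) (e z) \<notin> poly (\<phi> (u ^ (n - 1))) ` phi.span (lam ` {1..<i})"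
    using ex_small_division_point_new[OF i] by blast
  have "\<not> w (lam i) < w (e z)"
    using new phi.torsion_SMB_maximal[OF torsion_smb prime_u n_pos i z(3)] by blast
  then have le: "w z \<le> w (lam i)"
    using z(1) by (simp add: w_e_small)
  then show "lam i \<in> small_disc"
    using z(1) small_disc_mono by blast
  show "0 \<le> w (lam i)" if "i \<le> s"
    using z(2)[OF that] le by (rule order_trans)
qed

lemma ex1_small_preimage:
  assumes "i \<in> {1..r}"
  shows "\<exists>!z. z \<in> small_disc \<and> e z = lam i"
  using lam_small[OF assms] bij_betw_e_small_disc
  unfolding bij_betw_def inj_on_def by (metis imageE)

end

locale small_preimages = torsion_SMB_setting \<iota> w K s \<psi> \<Lambda> e \<phi> r n \<omega>0 lam u
  for \<iota> :: "'k::{field,finite} poly fract \<Rightarrow> 'c::alg_closed_field" and w K s \<psi> \<Lambda> e \<phi> r n \<omega>0 lam u +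
  fixes \<omega>' :: "nat \<Rightarrow> 'c"
  assumes small: "i \<in> {1..r} \<Longrightarrow> \<omega>' i \<in> small_disc"
    and e_preimage: "i \<in> {1..r} \<Longrightarrow> e (\<omega>' i) = lam i"
begin

abbreviation lattice_vector :: "nat \<Rightarrow> 'c" where
  "lattice_vector i \<equiv> poly (\<psi> (u ^ n)) (\<omega>' i)"

lemma w_preimage: "i \<in> {1..r} \<Longrightarrow> w (\<omega>' i) = w (lam i)"
  using w_e_small[OF small] e_preimage by simp

lemma lattice_vector_mem: "i \<in> {1..r} \<Longrightarrow> lattice_vector i \<in> \<Lambda>"
  using lam_torsion by (simp add: e_preimage flip: e_torsion_iff)

lemma preimage_torsion:
  assumes "i \<in> {1..s}"
  shows "\<omega>' i \<in> torsion \<psi> (u ^ n)"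
proof -
  have i: "i \<in> {1..r}"
    using assms s_less_r by auto
  have "0 \<le> w (\<omega>' i)"
    using w_preimage[OF i] lam_integral[OF i] assms by simp
  then have "lattice_vector i = 0"
    using lattice_integral_eq_0 lattice_vector_mem[OF i] w_act_nonneg by blast
  then show ?thesis
    by (simp add: torsion_def)
qed

lemma preimage_independent: "A_mod_independent \<psi> (u ^ n) {1..r} \<omega>'"
proof (rule A_mod_independent_if_exp)
  show "A_mod_independent \<phi> (u ^ n) {1..r} (\<lambda>j. e (\<omega>' j))"
    by (rule phi.A_mod_independent_reindex[OF lam_independent, of id]) (simp_all add: e_preimage)
qed

lemma span_preimages: "psi.span (\<omega>' ` {1..s}) = torsion \<psi> (u ^ n)"
  using psi.A_mod_independent_subset[OF preimage_independent, of "{1..s}"] preimage_torsion s_less_r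
  by (intro span_eq_torsion) auto

lemma torsion_SMB_preimage: "torsion_SMB w \<psi> s (u ^ n) \<omega>'"
  unfolding torsion_SMB_def
proof (intro ballI conjI impI)
  fix i assume i: "i \<in> {1..s}"
  then have ir: "i \<in> {1..r}"
    using s_less_r by auto
  show "\<omega>' i \<in> torsion \<psi> (u ^ n)"
    using i by (rule preimage_torsion)
  show "A_mod_independent \<psi> (u ^ n) {1..i} \<omega>'"
    by (rule psi.A_mod_independent_subset[OF preimage_independent]) (use ir in auto)
  fix y assume y: "y \<in> torsion \<psi> (u ^ n)"
    and indep: "A_mod_independent \<psi> (u ^ n) {1..i} (\<omega>'(i := y))"
  have "(\<omega>'(i := y)) j \<in> torsion \<psi> (u ^ n)" if "j \<in> {1..i}" for j
    using that i y preimage_torsion by auto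
  then have "A_mod_independent \<phi> (u ^ n) {1..i} (\<lambda>j. e ((\<omega>'(i := y)) j))"
    using w_torsion_nonneg[of _ "u ^ n"] by (intro A_mod_independent_exp_integral[OF indep]) auto
  then have "A_mod_independent \<phi> (u ^ n) {1..i} (lam(i := e y))"
    by (rule phi.A_mod_independent_reindex[where f = id]) (use ir e_preimage in auto)
  moreover have "e y \<in> torsion \<phi> (u ^ n)"
    unfolding e_torsion_iff using y zero_mem by (simp add: torsion_def)
  ultimately have "w (e y) \<le> w (lam i)"
    using torsion_smb ir by (simp add: torsion_SMB_def)
  moreover have "y \<in> small_disc"
    using y by (rule torsion_in_small_disc) simp
  ultimately show "w y \<le> w (\<omega>' i)"
    using w_preimage[OF ir] w_e_small by simp
qed

lemma lattice_vector_independent: "A_independent \<psi> {s + 1..r} lattice_vector"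
proof (rule psi.A_mod_independent_imp_A_independent)
  have "{1..r} = {1..s} \<union> {s + 1..r}"
    using s_less_r by auto
  then show "A_mod_independent \<psi> (u ^ n) {s + 1..r} lattice_vector"
    using preimage_independent span_preimages
    by (intro psi.A_mod_independent_quotient[of "{1..s}"]) auto
  show "0 < degree (u ^ n)"
    using prime_elem_degree_pos[OF prime_u] n_pos by (simp add: degree_power_eq)
  have "psi.span (lattice_vector ` {s + 1..r}) \<subseteq> \<Lambda>"
    using lattice_vector_mem by (intro psi.span_minimal subspace_lattice) auto
  then show "y = 0" if "y \<in> psi.span (lattice_vector ` {s + 1..r})" "poly (\<psi> (u ^ n)) y = 0" for y
    using lattice_torsion_free[of y "u ^ n"] that by auto
qed

lemma larger_lattice_vector_division_point:
  assumes i: "i \<in> {1..r}" and y: "y \<in> \<Lambda>" and less: "w (lattice_vector i) < w y"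
  obtains z v where "poly (\<psi> (u ^ n)) z = y" "v \<in> psi.span (\<omega>' ` {1..<i})"
    and "poly (\<psi> (u ^ (n - 1))) (z - v) \<in> \<Lambda>"
proof -
  obtain z where z: "poly (\<psi> (u ^ n)) z = y"
    using act_surj[of "u ^ n" y] by auto
  have "w (lattice_vector i) < 0"
    using w_lattice_neg[OF lattice_vector_mem[OF i]] less by (cases "lattice_vector i = 0") auto
  then have "w (\<omega>' i) < w z"
    using w_act_less_iff[of "u ^ n" "\<omega>' i" z] w_act_less_0_iff[of "u ^ n" "\<omega>' i"] less z by simp
  then have "w (lam i) < w (e z)"
    using w_e_small[of z] small_disc_mono[OF small[OF i], of z] w_preimage[OF i] by simp
  moreover have "e z \<in> torsion \<phi> (u ^ n)"
    using y by (simp add: e_torsion_iff z)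
  ultimately have "poly (\<phi> (u ^ (n - 1))) (e z) \<in> poly (\<phi> (u ^ (n - 1))) ` phi.span (lam ` {1..<i})"
    by (intro phi.torsion_SMB_maximal[OF torsion_smb prime_u n_pos i])
  moreover have "lam ` {1..<i} = e ` \<omega>' ` {1..<i}"
    unfolding image_image using i e_preimage by (intro image_cong) auto
  ultimately obtain v where v: "v \<in> psi.span (\<omega>' ` {1..<i})"
    and eq: "poly (\<phi> (u ^ (n - 1))) (e z) = poly (\<phi> (u ^ (n - 1))) (e v)"
    by (auto simp: exp.span_image)
  have "e (poly (\<psi> (u ^ (n - 1))) (z - v)) = 0"
    using eq by (simp add: e_act e_diff phi.scale_right_diff_distrib)
  then show ?thesis
    using that z v by (simp add: e_eq_0_iff)
qed

lemma span_lattice_vectors: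
  "psi.span (lattice_vector ` {1..<i}) = psi.span (lattice_vector ` {s + 1..<i})"
proof
  have "lattice_vector j \<in> psi.span (lattice_vector ` {s + 1..<i})" if "j \<in> {1..<i}" for j
  proof (cases "j \<le> s")
    case True
    then show ?thesis
      using preimage_torsion[of j] that by (simp add: torsion_def psi.span_zero)
  qed (use that in \<open>auto intro: psi.span_base\<close>)
  then show "psi.span (lattice_vector ` {1..<i}) \<subseteq> psi.span (lattice_vector ` {s + 1..<i})"
    by (intro psi.span_minimal psi.subspace_span) auto
  show "psi.span (lattice_vector ` {s + 1..<i}) \<subseteq> psi.span (lattice_vector ` {1..<i})"
    by (intro psi.span_mono image_mono) auto
qed

lemma larger_lattice_vector_congruent:
  assumes i: "i \<in> {1..r}" and y: "y \<in> \<Lambda>" and less: "w (lattice_vector i) < w y"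
  shows "\<exists>\<mu>\<in>\<Lambda>. y - poly (\<psi> u) \<mu> \<in> psi.span (lattice_vector ` {s + 1..<i})"
proof -
  obtain z v where z: "poly (\<psi> (u ^ n)) z = y" and v: "v \<in> psi.span (\<omega>' ` {1..<i})"
    and mem: "poly (\<psi> (u ^ (n - 1))) (z - v) \<in> \<Lambda>"
    using larger_lattice_vector_division_point[OF assms] .
  have "y - poly (\<psi> u) (poly (\<psi> (u ^ (n - 1))) (z - v)) = poly (\<psi> (u ^ n)) v"
    unfolding psi.scale_right_diff_distrib psi.scale_scale u_power_eq[symmetric] z by simp
  moreover have "poly (\<psi> (u ^ n)) v \<in> psi.span (lattice_vector ` {s + 1..<i})"
    unfolding span_lattice_vectors[symmetric]
    using v psi.span_act_image[of "u ^ n" "\<omega>' ` {1..<i}"] by (simp add: image_image)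
  ultimately show ?thesis
    using mem by metis
qed

lemma lattice_SMB_preimage: "lattice_SMB w \<psi> \<Lambda> s r lattice_vector"
  using prime_elem_degree_pos[OF prime_u] lattice_vector_independent larger_lattice_vector_congruent
  by (intro lattice_SMB_if_larger_congruent[of u]) (auto intro: lattice_vector_mem)

end

context completed_function_field
begin

sublocale valued_field w
  by unfold_locales (rule valuation)

lemma w_t_nonneg: "0 \<le> w (\<iota> (to_fract [:0, 1:]))"
proof (cases "\<iota> (to_fract [:0, 1:]) = 0")
  case False
  then obtain v where "w (\<iota> (to_fract [:0, 1:])) = ereal v"
    by (rule w_realE)
  then show ?thesis
    using finite_prime False by (simp add: w_divide zero_ereal_def)
qed simp

lemma drinfeld_uniformizationI:
  assumes tate: "tate_uniformization \<iota> w K r s \<phi> \<psi> \<Lambda> e"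
  shows "drinfeld_uniformization \<iota> w K s \<psi> \<Lambda> e \<phi>"
proof -
  interpret good_drinfeld_module \<iota> w K s \<psi>
    using tate embedding w_t_nonneg by unfold_locales (auto simp: tate_uniformization_def)
  have "psi.subspace \<Lambda>"
  proof -
    obtain b where "\<Lambda> = range (\<lambda>c. \<Sum>j\<in>{1..r - s}. poly (\<psi> (c j)) (b j))"
      using tate unfolding tate_uniformization_def A_lattice_def by blast
    then have "\<Lambda> = psi.span (b ` {1..r - s})"
      by (simp add: psi.span_family)
    then show ?thesis
      by simp
  qed
  then interpret drinfeld_lattice \<iota> w K s \<psi> \<Lambda>
    using tate by unfold_locales (auto simp: tate_uniformization_def A_lattice_def)
  show ?thesis
    using tate by unfold_locales (auto simp: tate_uniformization_def)
qed

lemma torsion_SMB_settingI: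
  assumes tate: "tate_uniformization \<iota> w K r s \<phi> \<psi> \<Lambda> e" and "s < r"
    and smb: "lattice_SMB w \<psi> \<Lambda> s r \<omega>0" and u: "irreducible u" and "0 < n"
    and ratio: "val_abs w s (\<omega>0 r) / val_abs w s (\<omega>0 (s + 1)) < ereal (deg_abs (u ^ n))"
    and "torsion_SMB w \<phi> r (u ^ n) lam"
  shows "torsion_SMB_setting \<iota> w K s \<psi> \<Lambda> e \<phi> r n \<omega>0 lam u"
proof -
  interpret drinfeld_uniformization \<iota> w K s \<psi> \<Lambda> e \<phi>
    using tate by (rule drinfeld_uniformizationI)
  have prime: "prime_elem u"
    using u by (rule field_poly_irreducible_imp_prime)
  have "w (poly (\<psi> (u ^ n)) (\<omega>0 (s + 1))) < w (\<omega>0 r)"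
    using lattice_SMB_neg[OF smb] \<open>s < r\<close> prime ratio
    by (intro w_act_less_if_val_abs_ratio_less) auto
  then show ?thesis
    using assms prime by unfold_locales
qed

end

theorem theorem4p2:
  fixes \<iota> :: "'k::{field,finite} poly fract \<Rightarrow> 'c::alg_closed_field"
    and w :: "'c \<Rightarrow> ereal"
    and F K \<Lambda> :: "'c set"
    and \<phi> \<psi> :: "'k poly \<Rightarrow> 'c poly"
    and e :: "'c \<Rightarrow> 'c"
    and \<omega>0 lam :: "nat \<Rightarrow> 'c"
    and u :: "'k poly"
    and r r' n :: nat
  assumes "completed_function_field \<iota> w F K"
    and "1 \<le> r'" and "r' < r"
    and "drinfeld_module \<iota> K r \<phi>"
    and "stable_reduction w r r' \<phi>"
    and "tate_uniformization \<iota> w K r r' \<phi> \<psi> \<Lambda> e"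
    and "lattice_SMB w \<psi> \<Lambda> r' r \<omega>0"
    and "irreducible u" and "lead_coeff u = 1"
    and "0 < n"
    and "ereal (deg_abs (u ^ n)) > val_abs w r' (\<omega>0 r) / val_abs w r' (\<omega>0 (r' + 1))"
    and "torsion_SMB w \<phi> r (u ^ n) lam"
  shows "(\<forall>i\<in>{1..r}. \<exists>!z. val_abs w r' z < val_abs w r' (\<omega>0 (r' + 1)) \<and> e z = lam i) \<and>
    (\<forall>\<omega>'. (\<forall>i\<in>{1..r}. val_abs w r' (\<omega>' i) < val_abs w r' (\<omega>0 (r' + 1)) \<and> e (\<omega>' i) = lam i) \<longrightarrow>
       torsion_SMB w \<psi> r' (u ^ n) \<omega>' \<and>
       lattice_SMB w \<psi> \<Lambda> r' r (\<lambda>i. dm_act \<psi> (u ^ n) (\<omega>' i)))"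
proof -
  interpret torsion_SMB_setting \<iota> w K r' \<psi> \<Lambda> e \<phi> r n \<omega>0 lam u
    using assms by (intro completed_function_field.torsion_SMB_settingI)
  have small: "val_abs w r' z < val_abs w r' (\<omega>0 (r' + 1)) \<longleftrightarrow> z \<in> small_disc" for z
    using assms(2) by (simp only: val_abs_less_iff small_disc_eq)
  show ?thesis
    unfolding small
  proof (intro conjI allI impI ballI ex1_small_preimage)
    fix \<omega>' assume "\<forall>i\<in>{1..r}. \<omega>' i \<in> small_disc \<and> e (\<omega>' i) = lam i"
    then interpret small_preimages \<iota> w K r' \<psi> \<Lambda> e \<phi> r n \<omega>0 lam u \<omega>'
      by unfold_locales auto
    show "torsion_SMB w \<psi> r' (u ^ n) \<omega>'"
      by (rule torsion_SMB_preimage)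
    show "lattice_SMB w \<psi> \<Lambda> r' r (\<lambda>i. dm_act \<psi> (u ^ n) (\<omega>' i))"
      by (rule lattice_SMB_preimage)
  qed
qed

end
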